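(* Let $L$ be a finite-dimensional supersolvable Lie algebra over a field $F$. Then $L$ is extreme if and only if one of the following holds: (i) $\dim L=1$; or (ii) $L/\phi(L)$ is the two-dimensional non-abelian Lie algebra.
   Context: $L$ is supersolvable if it has a chain of ideals $0=I_0\subset I_1\subset\cdots\subset I_m=L$ with $\dim I_j=j$. $N(L)$ is the nilradical of $L$; the upper nilpotent series is $N_0(L)=0$, $N_i(L)/N_{i-1}(L)=N(L/N_{i-1}(L))$, and the nilpotent length $n(L)$ is the smallest integer $m$ with $N_m(L)=L$. The Frattini subalgebra $\phi(L)$ is the intersection of the maximal subalgebras of $L$ (an ideal, since $L$ is solvable), and $\phi_i(L)/N_{i-1}(L)=\phi(L/N_{i-1}(L))$ for $i=1,2,\ldots$. For ideals $B\subset A$ of $L$, $A/B$ is a chief factor of $L$ if it is a minimal ideal of $L/B$. $L$ is extreme if $N_i(L)/\phi_i(L)$ is a chief factor of $L$ for each $i=1,\ldots,n(L)$.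
   Formalization: The formal theorem assumes L is nonzero: for L = 0 the nilpotent length is 0, so L is vacuously extreme, while neither dim L = 1 nor (ii) holds. *)

theory Defs
  imports "Jordan_Normal_Form.Missing_VectorSpace" "HOL-Algebra.QuotRing"
begin

text \<open>As in the vector space library, vector spaces are \<open>module\<close> records whose inherited fields
  \<open>mult\<close> and \<open>one\<close> are unused; the Lie bracket is a separate field.\<close>

record ('a, 'b) lie_algebra = "('a, 'b) module" +
  bracket :: "'b \<Rightarrow> 'b \<Rightarrow> 'b" (\<open>\<langle>_, _\<rangle>\<index>\<close>)

locale lie_algebra = vectorspace K L
  for K :: "('a, 'k) ring_scheme" (structure)
    and L :: "('a, 'b, 'm) lie_algebra_scheme" (structure) +
  assumes bracket_closed: "\<lbrakk>x \<in> carrier L; y \<in> carrier L\<rbrakk> \<Longrightarrow> \<langle>x, y\<rangle>\<^bsub>L\<^esub> \<in> carrier L"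
    and bracket_add_left: "\<lbrakk>x \<in> carrier L; y \<in> carrier L; z \<in> carrier L\<rbrakk> \<Longrightarrow>
      \<langle>x \<oplus>\<^bsub>L\<^esub> y, z\<rangle>\<^bsub>L\<^esub> = \<langle>x, z\<rangle>\<^bsub>L\<^esub> \<oplus>\<^bsub>L\<^esub> \<langle>y, z\<rangle>\<^bsub>L\<^esub>"
    and bracket_add_right: "\<lbrakk>x \<in> carrier L; y \<in> carrier L; z \<in> carrier L\<rbrakk> \<Longrightarrow>
      \<langle>x, y \<oplus>\<^bsub>L\<^esub> z\<rangle>\<^bsub>L\<^esub> = \<langle>x, y\<rangle>\<^bsub>L\<^esub> \<oplus>\<^bsub>L\<^esub> \<langle>x, z\<rangle>\<^bsub>L\<^esub>"
    and bracket_smult_left: "\<lbrakk>a \<in> carrier K; x \<in> carrier L; y \<in> carrier L\<rbrakk> \<Longrightarrow>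
      \<langle>a \<odot>\<^bsub>L\<^esub> x, y\<rangle>\<^bsub>L\<^esub> = a \<odot>\<^bsub>L\<^esub> \<langle>x, y\<rangle>\<^bsub>L\<^esub>"
    and bracket_smult_right: "\<lbrakk>a \<in> carrier K; x \<in> carrier L; y \<in> carrier L\<rbrakk> \<Longrightarrow>
      \<langle>x, a \<odot>\<^bsub>L\<^esub> y\<rangle>\<^bsub>L\<^esub> = a \<odot>\<^bsub>L\<^esub> \<langle>x, y\<rangle>\<^bsub>L\<^esub>"
    and bracket_self: "x \<in> carrier L \<Longrightarrow> \<langle>x, x\<rangle>\<^bsub>L\<^esub> = \<zero>\<^bsub>L\<^esub>"
    and jacobi: "\<lbrakk>x \<in> carrier L; y \<in> carrier L; z \<in> carrier L\<rbrakk> \<Longrightarrow>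
      \<langle>x, \<langle>y, z\<rangle>\<^bsub>L\<^esub>\<rangle>\<^bsub>L\<^esub> \<oplus>\<^bsub>L\<^esub> \<langle>y, \<langle>z, x\<rangle>\<^bsub>L\<^esub>\<rangle>\<^bsub>L\<^esub> \<oplus>\<^bsub>L\<^esub> \<langle>z, \<langle>x, y\<rangle>\<^bsub>L\<^esub>\<rangle>\<^bsub>L\<^esub> = \<zero>\<^bsub>L\<^esub>"

definition lie_subalgebra where
  "lie_subalgebra K S L \<longleftrightarrow>
     VectorSpace.subspace K S L \<and> (\<forall>x\<in>S. \<forall>y\<in>S. \<langle>x, y\<rangle>\<^bsub>L\<^esub> \<in> S)"

text \<open>One-sided absorption suffices, since the bracket is antisymmetric.\<close>

definition lie_ideal where
  "lie_ideal K I L \<longleftrightarrow>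
     VectorSpace.subspace K I L \<and> (\<forall>x\<in>carrier L. \<forall>y\<in>I. \<langle>x, y\<rangle>\<^bsub>L\<^esub> \<in> I)"

text \<open>The quotient by an ideal \<open>I\<close>, on the additive cosets of \<open>I\<close>.  Scalar multiplication and
  bracket are defined without choosing representatives, following \<^const>\<open>rcoset_mult\<close>.\<close>

definition lie_quot ::
    "('a, 'b, 'm) lie_algebra_scheme \<Rightarrow> 'b set \<Rightarrow> ('a, 'b set) lie_algebra" where
  "lie_quot L I =
     \<lparr>carrier = a_rcosets\<^bsub>L\<^esub> I, mult = rcoset_mult L I, one = I +>\<^bsub>L\<^esub> \<one>\<^bsub>L\<^esub>,
      zero = I, add = set_add L,
      smult = (\<lambda>a A. \<Union>x\<in>A. I +>\<^bsub>L\<^esub> (a \<odot>\<^bsub>L\<^esub> x)),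
      bracket = (\<lambda>A B. \<Union>x\<in>A. \<Union>y\<in>B. I +>\<^bsub>L\<^esub> \<langle>x, y\<rangle>\<^bsub>L\<^esub>)\<rparr>"

text \<open>The preimage in \<open>L\<close> of a set of cosets, used for subspaces \<open>J\<close> of \<open>L\<close> specified by
  \<open>J/I\<close>.\<close>

definition quot_preimage where
  "quot_preimage L I C = {x \<in> carrier L. I +>\<^bsub>L\<^esub> x \<in> C}"

definition lie_abelian where
  "lie_abelian L \<longleftrightarrow> (\<forall>x\<in>carrier L. \<forall>y\<in>carrier L. \<langle>x, y\<rangle>\<^bsub>L\<^esub> = \<zero>\<^bsub>L\<^esub>)"

definition supersolvable where
  "supersolvable K L \<longleftrightarrow>
     (\<exists>m (I :: nat \<Rightarrow> _ set).
        I 0 = {\<zero>\<^bsub>L\<^esub>} \<and> I m = carrier L \<and> (\<forall>j<m. I j \<subset> I (Suc j)) \<and>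
        (\<forall>j\<le>m. lie_ideal K (I j) L \<and> vectorspace.dim K (L\<lparr>carrier := I j\<rparr>) = j))"

primrec lower_central where
  "lower_central K L 0 = carrier L"
| "lower_central K L (Suc n) =
     LinearCombinations.module.span K L {\<langle>x, y\<rangle>\<^bsub>L\<^esub> | x y. x \<in> carrier L \<and> y \<in> lower_central K L n}"

definition lie_nilpotent where
  "lie_nilpotent K L \<longleftrightarrow> (\<exists>n. lower_central K L n = {\<zero>\<^bsub>L\<^esub>})"

text \<open>The sum of all nilpotent ideals, which is the largest nilpotent ideal when \<open>L\<close> is
  finite-dimensional.\<close>

definition nilradical where
  "nilradical K L =
     LinearCombinations.module.span K L
       (\<Union>{I. lie_ideal K I L \<and> lie_nilpotent K (L\<lparr>carrier := I\<rparr>)})"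

primrec upper_nilpotent where
  "upper_nilpotent K L 0 = {\<zero>\<^bsub>L\<^esub>}"
| "upper_nilpotent K L (Suc i) =
     quot_preimage L (upper_nilpotent K L i)
       (nilradical K (lie_quot L (upper_nilpotent K L i)))"

definition nilpotent_length where
  "nilpotent_length K L = (LEAST m. upper_nilpotent K L m = carrier L)"

definition maximal_subalgebra where
  "maximal_subalgebra K M L \<longleftrightarrow>
     lie_subalgebra K M L \<and> M \<noteq> carrier L \<and>
     (\<forall>S. lie_subalgebra K S L \<and> M \<subseteq> S \<longrightarrow> S = M \<or> S = carrier L)"

text \<open>The intersection is taken inside \<open>L\<close>, so it is \<open>L\<close> if there are no maximal
  subalgebras.\<close>

definition frattini where
  "frattini K L = {x \<in> carrier L. \<forall>M. maximal_subalgebra K M L \<longrightarrow> x \<in> M}"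

text \<open>Meaningful for \<open>i \<ge> 1\<close> only.\<close>

definition frattini_series where
  "frattini_series K L i =
     quot_preimage L (upper_nilpotent K L (i - 1))
       (frattini K (lie_quot L (upper_nilpotent K L (i - 1))))"

definition minimal_ideal where
  "minimal_ideal K I L \<longleftrightarrow>
     lie_ideal K I L \<and> I \<noteq> {\<zero>\<^bsub>L\<^esub>} \<and>
     (\<forall>J. lie_ideal K J L \<and> J \<subseteq> I \<longrightarrow> J = {\<zero>\<^bsub>L\<^esub>} \<or> J = I)"

text \<open>\<open>A/B\<close> is a chief factor of \<open>L\<close>.\<close>

definition chief_factor where
  "chief_factor K L A B \<longleftrightarrow>
     lie_ideal K A L \<and> lie_ideal K B L \<and> B \<subset> A \<and>
     minimal_ideal K ((\<lambda>x. B +>\<^bsub>L\<^esub> x) ` A) (lie_quot L B)"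

definition extreme where
  "extreme K L \<longleftrightarrow>
     (\<forall>i\<in>{1..nilpotent_length K L}.
        chief_factor K L (upper_nilpotent K L i) (frattini_series K L i))"

end

theory Submission
  imports Defs
begin

text \<open>Choose a flag of ideals of \<open>L\<close> with one-dimensional factors.  An element acts on each factor by a
  scalar, so the nilradical \<open>N\<close> is the set of all \<open>x\<close> with \<open>ad x\<close> nilpotent; it contains the derived
  algebra, whence \<open>N\<^sub>2(L) = L\<close>.  By Barnes' argument with the Fitting decomposition, \<open>ad x\<close> is already
  nilpotent if it is nilpotent modulo \<open>\<phi>(L)\<close>.

  If \<open>N/\<phi>(L)\<close> is a chief factor, it is spanned by a single \<open>e\<close>, and an element acting as zero on it maps
  \<open>L\<close> into \<open>\<phi>(L)\<close> in two steps, so it lies in \<open>N\<close>.  Hence \<open>L/N\<close> embeds into the scalars: either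
  \<open>L = \<phi>(L) + F e\<close>, which forces \<open>L = F e\<close>, or \<open>L/\<phi>(L)\<close> has dimension two and is not abelian.
  Conversely, if \<open>L/\<phi>(L)\<close> is the nonabelian algebra of dimension two, then \<open>N/\<phi>(L)\<close> and \<open>L/N\<close> are both
  one-dimensional.\<close>

section \<open>Subspaces of a vector space\<close>

text \<open>The quotient by \<open>frattini K L\<close> makes sense only once this intersection of
  subalgebras is known to be an ideal. Invariance under automorphisms exp(ad e) suggests itself, but
  the field is arbitrary and exponentials are not at hand. What helps is that a maximal subalgebra
  is complemented, modulo the largest ideal C inside it, by an abelian ideal (C + F e)/C: then (ad
  e)^2 maps L into C, and 1 + ad e is already an automorphism modulo C. Supersolvability enters only
  through flags with \<open>I (Suc j) = adjoin (I j) e\<close>. Strict inclusions and prescribed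
  dimensions would be lost in a quotient, whereas such flags survive. Nilpotency of
  \<open>ad x\<close> can be tested on a flag, and modulo an ideal J it reads
  \<open>ad_pow n x y \<in> J\<close>, so the N_i can be described inside L; the phi_i are described
  through the maximal subalgebras of L that contain N_(i-1). The zero algebra has to be excluded:
  its nilpotent length is 0, so it is vacuously extreme, yet it satisfies neither
  alternative.\<close>

context vectorspace
begin

abbreviation is_subspace :: "'c set \<Rightarrow> bool"
  where "is_subspace W \<equiv> VectorSpace.subspace K W V"

text \<open>The vector \<open>e\<close> may already lie in \<open>W\<close>, so passing from
  \<open>W\<close> to \<open>adjoin W e\<close> raises the dimension by at most one.\<close>

definition adjoin :: "'c set \<Rightarrow> 'c \<Rightarrow> 'c set"
  where "adjoin W e = {w \<oplus>\<^bsub>V\<^esub> t \<odot>\<^bsub>V\<^esub> e | w t. w \<in> W \<and> t \<in> carrier K}"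

lemma subspaceI:
  assumes "W \<subseteq> carrier V" "\<zero>\<^bsub>V\<^esub> \<in> W"
    and "\<And>v w. v \<in> W \<Longrightarrow> w \<in> W \<Longrightarrow> v \<oplus>\<^bsub>V\<^esub> w \<in> W"
    and "\<And>c v. c \<in> carrier K \<Longrightarrow> v \<in> W \<Longrightarrow> c \<odot>\<^bsub>V\<^esub> v \<in> W"
  shows "is_subspace W"
  unfolding VectorSpace.subspace_def submodule_def
  using assms vectorspace_axioms module_axioms by auto

lemma subspace_subset: "is_subspace W \<Longrightarrow> W \<subseteq> carrier V"
  and subspace_zero: "is_subspace W \<Longrightarrow> \<zero>\<^bsub>V\<^esub> \<in> W"
  and subspace_add: "is_subspace W \<Longrightarrow> v \<in> W \<Longrightarrow> w \<in> W \<Longrightarrow> v \<oplus>\<^bsub>V\<^esub> w \<in> W"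
  and subspace_smult: "is_subspace W \<Longrightarrow> c \<in> carrier K \<Longrightarrow> v \<in> W \<Longrightarrow> c \<odot>\<^bsub>V\<^esub> v \<in> W"
  by (auto simp: VectorSpace.subspace_def submodule_def)

lemma subspace_carrierD: "is_subspace W \<Longrightarrow> v \<in> W \<Longrightarrow> v \<in> carrier V"
  using subspace_subset by blast

lemma subspace_neg: "is_subspace W \<Longrightarrow> v \<in> W \<Longrightarrow> \<ominus>\<^bsub>V\<^esub> v \<in> W"
  using subspace_smult[of W "\<ominus>\<^bsub>K\<^esub> \<one>\<^bsub>K\<^esub>" v] smult_minus_1[OF subspace_carrierD]
  by (metis R.add.inv_closed R.one_closed)

lemma subspace_minus: "is_subspace W \<Longrightarrow> v \<in> W \<Longrightarrow> w \<in> W \<Longrightarrow> v \<ominus>\<^bsub>V\<^esub> w \<in> W"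
  by (simp add: a_minus_def subspace_add subspace_neg)

lemma subspace_add_cancel_left:
  assumes "is_subspace W" "v \<in> W" "w \<in> carrier V"
  shows "v \<oplus>\<^bsub>V\<^esub> w \<in> W \<longleftrightarrow> w \<in> W"
proof
  assume "v \<oplus>\<^bsub>V\<^esub> w \<in> W"
  then have "\<ominus>\<^bsub>V\<^esub> v \<oplus>\<^bsub>V\<^esub> (v \<oplus>\<^bsub>V\<^esub> w) \<in> W"
    using assms subspace_add subspace_neg by blast
  then show "w \<in> W"
    using assms by (simp add: M.r_neg1 subspace_carrierD)
qed (use assms subspace_add in blast)

lemma subspace_smult_cancel:
  assumes "is_subspace W" "t \<in> carrier K" "t \<noteq> \<zero>\<^bsub>K\<^esub>" "v \<in> carrier V"
  shows "t \<odot>\<^bsub>V\<^esub> v \<in> W \<longleftrightarrow> v \<in> W"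
proof
  assume "t \<odot>\<^bsub>V\<^esub> v \<in> W"
  then have "inv\<^bsub>K\<^esub> t \<odot>\<^bsub>V\<^esub> (t \<odot>\<^bsub>V\<^esub> v) \<in> W"
    by (rule subspace_smult[OF assms(1) inverse_exists[OF assms(2,3)]])
  then show "v \<in> W"
    using mult_inverse[OF assms(2,4) refl assms(3)] by metis
qed (use assms subspace_smult in blast)

lemma subspace_carrier: "is_subspace (carrier V)"
  by (rule subspaceI) auto

lemma subspace_trivial: "is_subspace {\<zero>\<^bsub>V\<^esub>}"
  by (rule subspaceI) auto

lemma adjoinE:
  assumes "v \<in> adjoin W e"
  obtains w t where "w \<in> W" "t \<in> carrier K" "v = w \<oplus>\<^bsub>V\<^esub> t \<odot>\<^bsub>V\<^esub> e"
  using assms by (auto simp: adjoin_def)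

lemma adjoinI:
  assumes "w \<in> W" "t \<in> carrier K"
  shows "w \<oplus>\<^bsub>V\<^esub> t \<odot>\<^bsub>V\<^esub> e \<in> adjoin W e"
  using assms by (auto simp: adjoin_def)

lemma adjoin_subset:
  assumes "is_subspace W" "e \<in> carrier V"
  shows "W \<subseteq> adjoin W e"
proof
  fix w assume w: "w \<in> W"
  then have "w \<oplus>\<^bsub>V\<^esub> \<zero>\<^bsub>K\<^esub> \<odot>\<^bsub>V\<^esub> e = w"
    using assms by (simp add: subspace_carrierD)
  then show "w \<in> adjoin W e"
    by (metis w adjoinI R.zero_closed)
qed

lemma adjoin_mem:
  assumes "is_subspace W" "e \<in> carrier V"
  shows "e \<in> adjoin W e"
proof -
  have "\<zero>\<^bsub>V\<^esub> \<oplus>\<^bsub>V\<^esub> \<one>\<^bsub>K\<^esub> \<odot>\<^bsub>V\<^esub> e = e"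
    using assms by simp
  then show ?thesis
    by (metis adjoinI R.one_closed assms(1) subspace_zero)
qed

lemma adjoin_minimal:
  assumes "is_subspace U" "W \<subseteq> U" "e \<in> U"
  shows "adjoin W e \<subseteq> U"
  using assms by (auto simp: adjoin_def intro!: subspace_add subspace_smult)

lemma subspace_adjoin:
  assumes W: "is_subspace W" and e: "e \<in> carrier V"
  shows "is_subspace (adjoin W e)"
proof (rule subspaceI)
  note [simp] = subspace_carrierD[OF W]
  show "adjoin W e \<subseteq> carrier V"
    using adjoin_minimal[OF subspace_carrier subspace_subset[OF W] e] .
  show "\<zero>\<^bsub>V\<^esub> \<in> adjoin W e"
    using adjoin_subset[OF assms] subspace_zero[OF W] by blast
  fix v w assume "v \<in> adjoin W e" "w \<in> adjoin W e"
  then obtain a s b t where v: "a \<in> W" "s \<in> carrier K" "v = a \<oplus>\<^bsub>V\<^esub> s \<odot>\<^bsub>V\<^esub> e"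
    and w: "b \<in> W" "t \<in> carrier K" "w = b \<oplus>\<^bsub>V\<^esub> t \<odot>\<^bsub>V\<^esub> e"
    by (metis adjoinE)
  have "v \<oplus>\<^bsub>V\<^esub> w = (a \<oplus>\<^bsub>V\<^esub> b) \<oplus>\<^bsub>V\<^esub> (s \<oplus>\<^bsub>K\<^esub> t) \<odot>\<^bsub>V\<^esub> e"
    using v w e by (simp add: smult_l_distr M.a_ac)
  then show "v \<oplus>\<^bsub>V\<^esub> w \<in> adjoin W e"
    using v w W by (simp add: adjoinI subspace_add)
next
  note [simp] = subspace_carrierD[OF W]
  fix c v assume "c \<in> carrier K" "v \<in> adjoin W e"
  then obtain a s where v: "c \<in> carrier K" "a \<in> W" "s \<in> carrier K" "v = a \<oplus>\<^bsub>V\<^esub> s \<odot>\<^bsub>V\<^esub> e"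
    by (metis adjoinE)
  have "c \<odot>\<^bsub>V\<^esub> v = c \<odot>\<^bsub>V\<^esub> a \<oplus>\<^bsub>V\<^esub> (c \<otimes>\<^bsub>K\<^esub> s) \<odot>\<^bsub>V\<^esub> e"
    using v e by (simp add: smult_r_distr smult_assoc1)
  then show "c \<odot>\<^bsub>V\<^esub> v \<in> adjoin W e"
    using v W by (simp add: adjoinI subspace_smult)
qed

text \<open>Steinitz exchange: in v = w + t e the scalar t cannot vanish, since v lies outside W; so
  e can be recovered from v.\<close>

lemma adjoin_exchange:
  assumes W: "is_subspace W" and e: "e \<in> carrier V" and v: "v \<in> adjoin W e" "v \<notin> W"
  shows "adjoin W v = adjoin W e"
proof -
  obtain w t where w: "w \<in> W" "t \<in> carrier K" "v = w \<oplus>\<^bsub>V\<^esub> t \<odot>\<^bsub>V\<^esub> e"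
    using v(1) by (rule adjoinE)
  have vc: "v \<in> carrier V"
    using subspace_carrierD[OF subspace_adjoin[OF W e] v(1)] .
  have "t \<noteq> \<zero>\<^bsub>K\<^esub>"
    using w v(2) e W by (auto simp: subspace_carrierD)
  moreover have "t \<odot>\<^bsub>V\<^esub> e \<in> adjoin W v"
    using subspace_add_cancel_left[OF subspace_adjoin[OF W vc], of w "t \<odot>\<^bsub>V\<^esub> e"]
      w e adjoin_subset[OF W vc] adjoin_mem[OF W vc] by auto
  ultimately have "e \<in> adjoin W v"
    using subspace_smult_cancel[OF subspace_adjoin[OF W vc] w(2)] e by blast
  then show ?thesis
    using adjoin_minimal[OF subspace_adjoin[OF W vc] adjoin_subset[OF W vc]]
      adjoin_minimal[OF subspace_adjoin[OF W e] adjoin_subset[OF W e] v(1)] by blast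
qed

text \<open>This absence of intermediate subspaces is the source both of the chief factors and of
  the maximal subalgebras found below.\<close>

lemma subspace_between_adjoin:
  assumes "is_subspace W" "e \<in> carrier V" "is_subspace U" "W \<subseteq> U" "U \<subseteq> adjoin W e"
  shows "U = W \<or> U = adjoin W e"
proof (cases "U = W")
  case False
  then obtain v where v: "v \<in> U" "v \<notin> W" using assms by blast
  then have "adjoin W v = adjoin W e"
    using adjoin_exchange assms by blast
  then show ?thesis
    using adjoin_minimal[OF assms(3,4) v(1)] assms(5) by blast
qed simp

section \<open>Dimensions of subspaces\<close>

text \<open>Independence does not depend on the ambient space, so independent subsets of W have at
  most dim V elements; one that is maximal is a basis of W.\<close>

lemma subspace_fin_dim:
  assumes "fin_dim" and W: "is_subspace W"
  shows "vectorspace.fin_dim K (vs W)"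
proof -
  interpret W: vectorspace K "vs W"
    using subspace_is_vs[OF W] .
  have li: "W.lin_indpt A \<longleftrightarrow> lin_indpt A" if "A \<subseteq> W" for A
    using span_li_not_depend(2)[OF that is_module[OF W]] by simp
  let ?P = "\<lambda>A. A \<subseteq> carrier (vs W) \<and> W.lin_indpt A"
  have bound: "finite A \<and> card A \<le> dim" if "?P A" for A
    using that li li_le_dim[OF \<open>fin_dim\<close>, of A] subspace_subset[OF W] by auto
  have "?P {}"
    by (simp add: W.lin_dep_def)
  from maximal_exists[of ?P, OF bound this] obtain A where "finite A" "maximal A ?P"
    by auto
  then show ?thesis
    using W.max_li_is_basis W.basis_def W.fin_dim_def by blast
qed

text \<open>A basis of U stays independent in W when a vector of W outside U is added.\<close>

lemma dim_strict_mono: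
  assumes fd: "fin_dim" and U: "is_subspace U" and W: "is_subspace W" and less: "U \<subset> W"
  shows "vectorspace.dim K (vs U) < vectorspace.dim K (vs W)"
proof -
  interpret U: vectorspace K "vs U" using subspace_is_vs[OF U] .
  interpret W: vectorspace K "vs W" using subspace_is_vs[OF W] .
  obtain B where B: "finite B" "U.basis B"
    using U.finite_basis_exists[OF subspace_fin_dim[OF fd U]] by blast
  then have BU: "B \<subseteq> U" "U.lin_indpt B" "U.span B = U"
    by (auto simp: U.basis_def)
  obtain w where w: "w \<in> W" "w \<notin> U" using less by blast
  have span: "W.span B = U" "W.lin_indpt B"
    using span_li_not_depend[OF _ is_module[OF U], of B]
      span_li_not_depend[OF _ is_module[OF W], of B] BU less by auto
  have "W.lin_indpt (B \<union> {w})"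
    using W.lin_dep_iff_in_span[of B w] span BU w less by auto
  then have "card (B \<union> {w}) \<le> W.dim"
    using W.li_le_dim(2)[OF subspace_fin_dim[OF fd W], of "B \<union> {w}"] BU w less by auto
  moreover have "w \<notin> B" using w BU by blast
  then have "card (B \<union> {w}) = Suc (card B)"
    using B by simp
  ultimately show ?thesis
    using U.dim_basis[OF B] by simp
qed

lemma dim_le:
  assumes fd: "fin_dim" and U: "is_subspace U"
  shows "vectorspace.dim K (vs U) \<le> dim"
proof (cases "U = carrier V")
  case True
  have "vs (carrier V) = V" by simp
  then show ?thesis using True by simp
next
  case False
  then have "U \<subset> carrier V" using subspace_subset[OF U] by blast
  moreover have "vs (carrier V) = V" by simp
  ultimately show ?thesis
    using dim_strict_mono[OF fd U subspace_carrier] by simp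
qed

text \<open>A member of largest dimension replaces an appeal to Zorn. It yields maximal subalgebras
  as well as the largest ideal inside a subalgebra.\<close>

lemma exists_maximal_subspace:
  assumes fd: "fin_dim" and P: "P W" and sub: "\<And>U. P U \<Longrightarrow> is_subspace U"
  obtains U where "P U" "W \<subseteq> U" "\<And>S. P S \<Longrightarrow> U \<subseteq> S \<Longrightarrow> S = U"
proof -
  let ?Q = "\<lambda>U. P U \<and> W \<subseteq> U" and ?d = "\<lambda>U. vectorspace.dim K (vs U)"
  have "?Q W" using P by simp
  moreover have "\<forall>U. ?Q U \<longrightarrow> ?d U < Suc dim"
    using dim_le[OF fd sub] by (simp add: less_Suc_eq_le)
  ultimately obtain U where U: "?Q U" "\<forall>S. ?Q S \<longrightarrow> ?d S \<le> ?d U"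
    using ex_has_greatest_nat[of ?Q W ?d "Suc dim"] by blast
  show thesis
  proof (rule that[of U])
    fix S assume S: "P S" "U \<subseteq> S"
    then have "?d S \<le> ?d U" using U by auto
    then have "\<not> U \<subset> S"
      using dim_strict_mono[OF fd sub sub, of U S] U(1) S(1) by auto
    then show "S = U" using S(2) by blast
  qed (use U in auto)
qed

lemma dim_trivial: "vectorspace.dim K (vs {\<zero>\<^bsub>V\<^esub>}) = 0"
proof -
  interpret Z: vectorspace K "vs {\<zero>\<^bsub>V\<^esub>}"
    using subspace_is_vs[OF subspace_trivial] .
  have "Z.span {\<zero>\<^bsub>V\<^esub>} = {\<zero>\<^bsub>V\<^esub>}"
    using Z.span_is_subset2[of "{\<zero>\<^bsub>V\<^esub>}"] Z.in_own_span[of "{\<zero>\<^bsub>V\<^esub>}"] by auto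
  then show ?thesis
    using Z.dim0I by simp
qed

lemma dim_adjoin:
  assumes fd: "fin_dim" and W: "is_subspace W" and e: "e \<in> carrier V" "e \<notin> W"
  shows "vectorspace.dim K (vs (adjoin W e)) = Suc (vectorspace.dim K (vs W))"
proof (rule antisym)
  note A = subspace_adjoin[OF W e(1)]
  interpret W: vectorspace K "vs W" using subspace_is_vs[OF W] .
  interpret A: vectorspace K "vs (adjoin W e)" using subspace_is_vs[OF A] .
  show "Suc W.dim \<le> A.dim"
  proof -
    have "W \<subset> adjoin W e"
      using adjoin_subset[OF W e(1)] adjoin_mem[OF W e(1)] e(2) by blast
    then show ?thesis
      using dim_strict_mono[OF fd W A] by simp
  qed
  obtain B where B: "finite B" "W.basis B"
    using W.finite_basis_exists[OF subspace_fin_dim[OF fd W]] by blast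
  then have BW: "B \<subseteq> W" "W.span B = W"
    by (auto simp: W.basis_def)
  then have spB: "span B = W"
    using span_li_not_depend(1)[OF BW(1) is_module[OF W]] by simp
  have sub: "insert e B \<subseteq> adjoin W e"
    using BW adjoin_subset[OF W e(1)] adjoin_mem[OF W e(1)] by blast
  have subV: "insert e B \<subseteq> carrier V"
    using sub subspace_subset[OF A] by blast
  have "adjoin W e \<subseteq> span (insert e B)"
    using adjoin_minimal[OF span_is_subspace[OF subV], of W e] span_is_monotone[of B "insert e B"]
      spB in_own_span[OF subV] by blast
  then have "A.span (insert e B) = adjoin W e"
    using span_li_not_depend(1)[OF sub is_module[OF A]] span_is_subset[OF sub is_module[OF A]] by simp
  then have "A.dim \<le> card (insert e B)"
    using A.gen_ge_dim[of "insert e B"] B(1) sub by simp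
  also have "\<dots> \<le> Suc W.dim"
    using W.dim_basis[OF B] card_insert_le_m1[of "Suc (card B)" B e] by simp
  finally show "A.dim \<le> Suc W.dim" .
qed

lemma subspace_eq_carrier:
  assumes fd: "fin_dim" and U: "is_subspace U" and d: "vectorspace.dim K (vs U) = dim"
  shows "U = carrier V"
proof (rule ccontr)
  assume "U \<noteq> carrier V"
  then have "U \<subset> carrier V" using subspace_subset[OF U] by blast
  then show False
    using dim_strict_mono[OF fd U subspace_carrier] d by simp
qed

end

section \<open>Ideals and quotients\<close>

context lie_algebra
begin

lemma lie_idealI:
  assumes "is_subspace I" "\<And>x y. x \<in> carrier L \<Longrightarrow> y \<in> I \<Longrightarrow> \<langle>x, y\<rangle>\<^bsub>L\<^esub> \<in> I"
  shows "lie_ideal K I L"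
  using assms by (auto simp: lie_ideal_def)

lemma ideal_subspace: "lie_ideal K I L \<Longrightarrow> is_subspace I"
  and ideal_bracket: "lie_ideal K I L \<Longrightarrow> x \<in> carrier L \<Longrightarrow> y \<in> I \<Longrightarrow> \<langle>x, y\<rangle>\<^bsub>L\<^esub> \<in> I"
  by (auto simp: lie_ideal_def)

lemma ideal_subset: "lie_ideal K I L \<Longrightarrow> I \<subseteq> carrier L"
  and ideal_carrierD: "lie_ideal K I L \<Longrightarrow> x \<in> I \<Longrightarrow> x \<in> carrier L"
  using subspace_subset[OF ideal_subspace] by blast+

lemma subalgebra_subspace: "lie_subalgebra K S L \<Longrightarrow> is_subspace S"
  and subalgebra_bracket: "lie_subalgebra K S L \<Longrightarrow> x \<in> S \<Longrightarrow> y \<in> S \<Longrightarrow> \<langle>x, y\<rangle>\<^bsub>L\<^esub> \<in> S"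
  by (auto simp: lie_subalgebra_def)

lemma ideal_subalgebra: "lie_ideal K I L \<Longrightarrow> lie_subalgebra K I L"
  using ideal_carrierD by (auto simp: lie_ideal_def lie_subalgebra_def)

lemma bracket_zero_right [simp]: "x \<in> carrier L \<Longrightarrow> \<langle>x, \<zero>\<^bsub>L\<^esub>\<rangle>\<^bsub>L\<^esub> = \<zero>\<^bsub>L\<^esub>"
  using bracket_smult_right[of \<zero> x "\<zero>\<^bsub>L\<^esub>"] bracket_closed[of x "\<zero>\<^bsub>L\<^esub>"] by simp

lemma bracket_zero_left [simp]: "x \<in> carrier L \<Longrightarrow> \<langle>\<zero>\<^bsub>L\<^esub>, x\<rangle>\<^bsub>L\<^esub> = \<zero>\<^bsub>L\<^esub>"
  using bracket_smult_left[of \<zero> "\<zero>\<^bsub>L\<^esub>" x] bracket_closed[of "\<zero>\<^bsub>L\<^esub>" x] by simp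

lemma bracket_antisym:
  assumes "x \<in> carrier L" "y \<in> carrier L"
  shows "\<langle>y, x\<rangle>\<^bsub>L\<^esub> = \<ominus>\<^bsub>L\<^esub> \<langle>x, y\<rangle>\<^bsub>L\<^esub>"
proof -
  have "\<langle>y \<oplus>\<^bsub>L\<^esub> x, y \<oplus>\<^bsub>L\<^esub> x\<rangle>\<^bsub>L\<^esub> = \<langle>y, x\<rangle>\<^bsub>L\<^esub> \<oplus>\<^bsub>L\<^esub> \<langle>x, y\<rangle>\<^bsub>L\<^esub>"
    using assms bracket_self[OF assms(1)] bracket_self[OF assms(2)]
    by (simp add: bracket_add_left bracket_add_right bracket_closed M.a_comm)
  then have "\<langle>y, x\<rangle>\<^bsub>L\<^esub> \<oplus>\<^bsub>L\<^esub> \<langle>x, y\<rangle>\<^bsub>L\<^esub> = \<zero>\<^bsub>L\<^esub>"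
    using assms bracket_self[of "y \<oplus>\<^bsub>L\<^esub> x"] by (metis M.add.m_closed)
  then show ?thesis
    using assms M.minus_equality bracket_closed by metis
qed

lemma bracket_neg_right:
  assumes "x \<in> carrier L" "y \<in> carrier L"
  shows "\<langle>x, \<ominus>\<^bsub>L\<^esub> y\<rangle>\<^bsub>L\<^esub> = \<ominus>\<^bsub>L\<^esub> \<langle>x, y\<rangle>\<^bsub>L\<^esub>"
  using bracket_smult_right[of "\<ominus> \<one>" x y] assms
  by (metis smult_minus_1 R.add.inv_closed R.one_closed bracket_closed)

lemma bracket_minus_right:
  assumes "x \<in> carrier L" "y \<in> carrier L" "z \<in> carrier L"
  shows "\<langle>x, y \<ominus>\<^bsub>L\<^esub> z\<rangle>\<^bsub>L\<^esub> = \<langle>x, y\<rangle>\<^bsub>L\<^esub> \<ominus>\<^bsub>L\<^esub> \<langle>x, z\<rangle>\<^bsub>L\<^esub>"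
  using assms by (simp add: a_minus_def bracket_add_right bracket_neg_right)

text \<open>The Jacobi identity as ad [x, y] = [ad x, ad y]: a bracket acts on any factor as a
  commutator of endomorphisms.\<close>

lemma bracket_bracket_left:
  assumes "x \<in> carrier L" "y \<in> carrier L" "z \<in> carrier L"
  shows "\<langle>\<langle>x, y\<rangle>\<^bsub>L\<^esub>, z\<rangle>\<^bsub>L\<^esub> = \<langle>x, \<langle>y, z\<rangle>\<^bsub>L\<^esub>\<rangle>\<^bsub>L\<^esub> \<ominus>\<^bsub>L\<^esub> \<langle>y, \<langle>x, z\<rangle>\<^bsub>L\<^esub>\<rangle>\<^bsub>L\<^esub>"
proof -
  have c: "\<langle>x, \<langle>y, z\<rangle>\<^bsub>L\<^esub>\<rangle>\<^bsub>L\<^esub> \<in> carrier L" "\<langle>y, \<langle>x, z\<rangle>\<^bsub>L\<^esub>\<rangle>\<^bsub>L\<^esub> \<in> carrier L" "\<langle>z, \<langle>x, y\<rangle>\<^bsub>L\<^esub>\<rangle>\<^bsub>L\<^esub> \<in> carrier L"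
    using assms bracket_closed by auto
  have 1: "\<langle>\<langle>x, y\<rangle>\<^bsub>L\<^esub>, z\<rangle>\<^bsub>L\<^esub> = \<ominus>\<^bsub>L\<^esub> \<langle>z, \<langle>x, y\<rangle>\<^bsub>L\<^esub>\<rangle>\<^bsub>L\<^esub>"
    using bracket_antisym[of z "\<langle>x, y\<rangle>\<^bsub>L\<^esub>"] assms bracket_closed by blast
  have "\<langle>y, \<langle>z, x\<rangle>\<^bsub>L\<^esub>\<rangle>\<^bsub>L\<^esub> = \<ominus>\<^bsub>L\<^esub> \<langle>y, \<langle>x, z\<rangle>\<^bsub>L\<^esub>\<rangle>\<^bsub>L\<^esub>"
    using bracket_antisym[of x z] bracket_neg_right[of y "\<langle>x, z\<rangle>\<^bsub>L\<^esub>"] assms bracket_closed by simp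
  then have "(\<langle>x, \<langle>y, z\<rangle>\<^bsub>L\<^esub>\<rangle>\<^bsub>L\<^esub> \<ominus>\<^bsub>L\<^esub> \<langle>y, \<langle>x, z\<rangle>\<^bsub>L\<^esub>\<rangle>\<^bsub>L\<^esub>) \<oplus>\<^bsub>L\<^esub> \<langle>z, \<langle>x, y\<rangle>\<^bsub>L\<^esub>\<rangle>\<^bsub>L\<^esub> = \<zero>\<^bsub>L\<^esub>"
    using jacobi[OF assms] by (simp add: a_minus_def)
  then show ?thesis
    unfolding 1 using c M.minus_equality M.minus_closed by metis
qed

lemma bracket_derivation:
  assumes "x \<in> carrier L" "y \<in> carrier L" "z \<in> carrier L"
  shows "\<langle>x, \<langle>y, z\<rangle>\<^bsub>L\<^esub>\<rangle>\<^bsub>L\<^esub> = \<langle>\<langle>x, y\<rangle>\<^bsub>L\<^esub>, z\<rangle>\<^bsub>L\<^esub> \<oplus>\<^bsub>L\<^esub> \<langle>y, \<langle>x, z\<rangle>\<^bsub>L\<^esub>\<rangle>\<^bsub>L\<^esub>"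
  unfolding bracket_bracket_left[OF assms]
  using assms bracket_closed by (simp add: a_minus_def M.a_assoc M.l_neg)

lemma ideal_bracket_left:
  assumes "lie_ideal K I L" "x \<in> carrier L" "y \<in> I"
  shows "\<langle>y, x\<rangle>\<^bsub>L\<^esub> \<in> I"
  using ideal_bracket[OF assms] bracket_antisym[of x y] ideal_carrierD[OF assms(1,3)] assms
    subspace_neg[OF ideal_subspace] by metis

lemma trivial_ideal: "lie_ideal K {\<zero>\<^bsub>L\<^esub>} L"
  using subspace_trivial by (auto intro!: lie_idealI)

lemma carrier_ideal: "lie_ideal K (carrier L) L"
  using subspace_carrier bracket_closed by (auto intro!: lie_idealI)

text \<open>Since B absorbs brackets, only the new generator has to be tested.\<close>

lemma adjoin_ideal:
  assumes B: "lie_ideal K B L" and e: "e \<in> carrier L"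
    and br: "\<And>x. x \<in> carrier L \<Longrightarrow> \<langle>x, e\<rangle>\<^bsub>L\<^esub> \<in> adjoin B e"
  shows "lie_ideal K (adjoin B e) L"
proof (rule lie_idealI)
  note Bs = ideal_subspace[OF B]
  show S: "is_subspace (adjoin B e)"
    using subspace_adjoin[OF Bs e] .
  fix x y assume x: "x \<in> carrier L" and "y \<in> adjoin B e"
  then obtain b t where y: "b \<in> B" "t \<in> carrier K" "y = b \<oplus>\<^bsub>L\<^esub> t \<odot>\<^bsub>L\<^esub> e"
    by (metis adjoinE)
  have "\<langle>x, y\<rangle>\<^bsub>L\<^esub> = \<langle>x, b\<rangle>\<^bsub>L\<^esub> \<oplus>\<^bsub>L\<^esub> t \<odot>\<^bsub>L\<^esub> \<langle>x, e\<rangle>\<^bsub>L\<^esub>"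
    using x y e ideal_carrierD[OF B] by (simp add: bracket_add_right bracket_smult_right)
  moreover have "\<langle>x, b\<rangle>\<^bsub>L\<^esub> \<in> adjoin B e"
    using ideal_bracket[OF B x y(1)] adjoin_subset[OF Bs e] by blast
  ultimately show "\<langle>x, y\<rangle>\<^bsub>L\<^esub> \<in> adjoin B e"
    using S br[OF x] y subspace_add subspace_smult by metis
qed

lemma ideal_abelian_subgroup:
  assumes "lie_ideal K I L"
  shows "abelian_subgroup I L"
proof (rule abelian_subgroupI3)
  have "subgroup I (add_monoid L)"
    using subspace_subset[OF ideal_subspace[OF assms]] subspace_zero[OF ideal_subspace[OF assms]]
      subspace_add[OF ideal_subspace[OF assms]] subspace_neg[OF ideal_subspace[OF assms]]
    by (auto simp: subgroup_def a_inv_def)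
  then show "additive_subgroup I L"
    by (rule additive_subgroup.intro)
qed (rule M.abelian_group_axioms)

end

section \<open>The quotient Lie algebra by an ideal\<close>

locale lie_quotient = lie_algebra +
  fixes I
  assumes ideal: "lie_ideal K I L"
begin

abbreviation proj :: "'c \<Rightarrow> 'c set" (\<open>\<pi>\<close>)
  where "\<pi> x \<equiv> I +>\<^bsub>L\<^esub> x"

sublocale abelian_subgroup I L
  using ideal_abelian_subgroup[OF ideal] .

lemmas subspace_I = ideal_subspace[OF ideal]

lemma proj_eq_iff:
  assumes "x \<in> carrier L" "y \<in> carrier L"
  shows "\<pi> x = \<pi> y \<longleftrightarrow> x \<ominus>\<^bsub>L\<^esub> y \<in> I"
proof -
  have "x \<in> \<pi> y \<longleftrightarrow> x \<ominus>\<^bsub>L\<^esub> y \<in> I"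
    using a_rcos_module[of y x] assms by (simp add: a_minus_def)
  moreover have "\<pi> x = \<pi> y \<longleftrightarrow> x \<in> \<pi> y"
    using a_rcos_self[of x] a_repr_independence[of x I y] a_subgroup assms by metis
  ultimately show ?thesis by simp
qed

lemma mem_proj: "x \<in> carrier L \<Longrightarrow> y \<in> \<pi> x \<Longrightarrow> y \<in> carrier L \<and> \<pi> y = \<pi> x"
  using a_repr_independence[of y I x] a_subgroup a_r_coset_subset_G[of I x] ideal_subset[OF ideal]
  by blast

lemma proj_zero: "\<pi> \<zero>\<^bsub>L\<^esub> = I"
  using ideal_subset[OF ideal] by (auto simp: a_r_coset_def')

lemma proj_eq_zero_iff: "x \<in> carrier L \<Longrightarrow> \<pi> x = I \<longleftrightarrow> x \<in> I"
  using proj_eq_iff[of x "\<zero>\<^bsub>L\<^esub>"] proj_zero M.minus_equality[of "\<zero>\<^bsub>L\<^esub>" "\<zero>\<^bsub>L\<^esub>"]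
  by (simp add: a_minus_def)

lemma quot_carrier: "carrier (lie_quot L I) = \<pi> ` carrier L"
  by (auto simp: lie_quot_def A_RCOSETS_def')

lemma quot_zero: "\<zero>\<^bsub>lie_quot L I\<^esub> = I"
  by (simp add: lie_quot_def)

lemma quot_add:
  assumes "x \<in> carrier L" "y \<in> carrier L"
  shows "\<pi> x \<oplus>\<^bsub>lie_quot L I\<^esub> \<pi> y = \<pi> (x \<oplus>\<^bsub>L\<^esub> y)"
  using a_rcos_sum[OF assms] by (simp add: lie_quot_def)

text \<open>All representatives give the same coset, so the union in \<open>lie_quot\<close>
  collapses to a single one.\<close>

lemma quot_smult:
  assumes "a \<in> carrier K" "x \<in> carrier L"
  shows "a \<odot>\<^bsub>lie_quot L I\<^esub> \<pi> x = \<pi> (a \<odot>\<^bsub>L\<^esub> x)"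
proof -
  have "\<pi> (a \<odot>\<^bsub>L\<^esub> y) = \<pi> (a \<odot>\<^bsub>L\<^esub> x)" if y: "y \<in> \<pi> x" for y
  proof -
    have yc: "y \<in> carrier L" "y \<ominus>\<^bsub>L\<^esub> x \<in> I"
      using mem_proj[OF assms(2) y] proj_eq_iff[of y x] assms by auto
    have "a \<odot>\<^bsub>L\<^esub> y \<ominus>\<^bsub>L\<^esub> a \<odot>\<^bsub>L\<^esub> x = a \<odot>\<^bsub>L\<^esub> (y \<ominus>\<^bsub>L\<^esub> x)"
      using assms yc by (simp add: a_minus_def smult_r_distr smult_r_minus)
    then show ?thesis
      using proj_eq_iff[of "a \<odot>\<^bsub>L\<^esub> y" "a \<odot>\<^bsub>L\<^esub> x"] subspace_smult[OF subspace_I assms(1) yc(2)] assms yc by simp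
  qed
  then have "(\<Union>y\<in>\<pi> x. \<pi> (a \<odot>\<^bsub>L\<^esub> y)) = \<pi> (a \<odot>\<^bsub>L\<^esub> x)"
    using a_rcos_self[OF assms(2)] by blast
  then show ?thesis
    by (simp add: lie_quot_def)
qed

lemma quot_bracket:
  assumes "x \<in> carrier L" "y \<in> carrier L"
  shows "\<langle>\<pi> x, \<pi> y\<rangle>\<^bsub>lie_quot L I\<^esub> = \<pi> \<langle>x, y\<rangle>\<^bsub>L\<^esub>"
proof -
  have "\<pi> \<langle>u, v\<rangle>\<^bsub>L\<^esub> = \<pi> \<langle>x, y\<rangle>\<^bsub>L\<^esub>" if u: "u \<in> \<pi> x" and v: "v \<in> \<pi> y" for u v
  proof -
    have c: "u \<in> carrier L" "u \<ominus>\<^bsub>L\<^esub> x \<in> I" "v \<in> carrier L" "v \<ominus>\<^bsub>L\<^esub> y \<in> I"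
      using mem_proj[OF _ u] mem_proj[OF _ v] proj_eq_iff assms by auto
    \<comment> \<open>Telescoping: [u, v] - [x, y] = [u - x, v] + [x, v - y], and each bracket on
      the right has an entry in \<open>I\<close>.\<close>
    have "\<langle>u \<ominus>\<^bsub>L\<^esub> x, v\<rangle>\<^bsub>L\<^esub> \<oplus>\<^bsub>L\<^esub> \<langle>x, v \<ominus>\<^bsub>L\<^esub> y\<rangle>\<^bsub>L\<^esub> \<in> I"
      using ideal_bracket[OF ideal assms(1) c(4)] ideal_bracket_left[OF ideal c(3,2)]
        subspace_add[OF subspace_I] by blast
    moreover have "\<langle>u, v\<rangle>\<^bsub>L\<^esub> = \<langle>u \<ominus>\<^bsub>L\<^esub> x, v\<rangle>\<^bsub>L\<^esub> \<oplus>\<^bsub>L\<^esub> \<langle>x, v\<rangle>\<^bsub>L\<^esub>"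
      using bracket_add_left[of "u \<ominus>\<^bsub>L\<^esub> x" x v] c assms by (simp add: a_minus_def M.a_assoc M.l_neg)
    moreover have "\<langle>x, v \<ominus>\<^bsub>L\<^esub> y\<rangle>\<^bsub>L\<^esub> = \<langle>x, v\<rangle>\<^bsub>L\<^esub> \<ominus>\<^bsub>L\<^esub> \<langle>x, y\<rangle>\<^bsub>L\<^esub>"
      using bracket_minus_right c assms by blast
    ultimately have "\<langle>u, v\<rangle>\<^bsub>L\<^esub> \<ominus>\<^bsub>L\<^esub> \<langle>x, y\<rangle>\<^bsub>L\<^esub> \<in> I"
      using c assms bracket_closed by (simp add: a_minus_def M.a_assoc)
    then show ?thesis
      using proj_eq_iff[of "\<langle>u, v\<rangle>\<^bsub>L\<^esub>" "\<langle>x, y\<rangle>\<^bsub>L\<^esub>"] c assms bracket_closed by simp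
  qed
  then have "(\<Union>u\<in>\<pi> x. \<Union>v\<in>\<pi> y. \<pi> \<langle>u, v\<rangle>\<^bsub>L\<^esub>) = \<pi> \<langle>x, y\<rangle>\<^bsub>L\<^esub>"
    using a_rcos_self[OF assms(1)] a_rcos_self[OF assms(2)] by blast
  then show ?thesis
    by (simp add: lie_quot_def)
qed

lemma quot_lie_algebra: "lie_algebra K (lie_quot L I)"
proof -
  have "vectorspace K (lie_quot L I)"
  proof (rule vs_criteria)
    show "\<forall>v\<in>carrier (lie_quot L I). \<exists>w\<in>carrier (lie_quot L I). v \<oplus>\<^bsub>lie_quot L I\<^esub> w = \<zero>\<^bsub>lie_quot L I\<^esub>"
    proof
      fix v assume "v \<in> carrier (lie_quot L I)"
      then obtain x where x: "x \<in> carrier L" "v = \<pi> x" by (auto simp: quot_carrier)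
      then have "v \<oplus>\<^bsub>lie_quot L I\<^esub> \<pi> (\<ominus>\<^bsub>L\<^esub> x) = \<zero>\<^bsub>lie_quot L I\<^esub>"
        by (simp add: quot_add quot_zero M.r_neg proj_zero)
      then show "\<exists>w\<in>carrier (lie_quot L I). v \<oplus>\<^bsub>lie_quot L I\<^esub> w = \<zero>\<^bsub>lie_quot L I\<^esub>"
        using x by (auto simp: quot_carrier)
    qed
    show "\<zero>\<^bsub>lie_quot L I\<^esub> \<in> carrier (lie_quot L I)"
      using proj_zero quot_zero by (auto simp: quot_carrier)
    show "\<forall>v\<in>carrier (lie_quot L I). v \<oplus>\<^bsub>lie_quot L I\<^esub> \<zero>\<^bsub>lie_quot L I\<^esub> = v"
    proof
      fix v assume "v \<in> carrier (lie_quot L I)"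
      then obtain x where x: "x \<in> carrier L" "v = \<pi> x" by (auto simp: quot_carrier)
      have "\<pi> x \<oplus>\<^bsub>lie_quot L I\<^esub> \<pi> \<zero>\<^bsub>L\<^esub> = \<pi> x"
        using x by (subst quot_add) auto
      then show "v \<oplus>\<^bsub>lie_quot L I\<^esub> \<zero>\<^bsub>lie_quot L I\<^esub> = v"
        using x by (simp add: quot_zero proj_zero)
    qed
    show "field K" ..
  qed (auto simp: quot_carrier quot_add quot_smult M.a_ac smult_assoc1 smult_l_distr smult_r_distr)
  moreover have "lie_algebra_axioms K (lie_quot L I)"
    by (rule lie_algebra_axioms.intro)
      (auto simp: quot_carrier quot_add quot_smult quot_bracket quot_zero bracket_closed bracket_add_left
        bracket_add_right bracket_smult_left bracket_smult_right bracket_self jacobi proj_zero)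
  ultimately show ?thesis
    by (rule lie_algebra.intro)
qed

sublocale quot: lie_algebra K "lie_quot L I"
  by (rule quot_lie_algebra)

end

context lie_algebra
begin

lemma lie_quotientI: "lie_ideal K I L \<Longrightarrow> lie_quotient K L I"
  by unfold_locales

abbreviation ad_pow :: "nat \<Rightarrow> 'b \<Rightarrow> 'b \<Rightarrow> 'b"
  where "ad_pow n x y \<equiv> (bracket L x ^^ n) y"

lemma ad_pow_closed [simp]:
  "x \<in> carrier L \<Longrightarrow> y \<in> carrier L \<Longrightarrow> ad_pow n x y \<in> carrier L"
  by (induction n) (auto simp: bracket_closed)

end

section \<open>Correspondence between the quotient and the algebra\<close>

context lie_quotient
begin

lemma mem_image_proj_iff:
  assumes U: "is_subspace U" and IU: "I \<subseteq> U" and x: "x \<in> carrier L"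
  shows "\<pi> x \<in> \<pi> ` U \<longleftrightarrow> x \<in> U"
proof
  assume "\<pi> x \<in> \<pi> ` U"
  then obtain u where u: "u \<in> U" "\<pi> x = \<pi> u" by blast
  then have "x \<ominus>\<^bsub>L\<^esub> u \<in> U"
    using proj_eq_iff x subspace_carrierD[OF U] IU by blast
  then have "(x \<ominus>\<^bsub>L\<^esub> u) \<oplus>\<^bsub>L\<^esub> u \<in> U"
    using subspace_add[OF U] u by blast
  then show "x \<in> U"
    using x subspace_carrierD[OF U u(1)] by (simp add: a_minus_def M.a_assoc M.l_neg)
qed blast

lemma image_subspace:
  assumes U: "is_subspace U"
  shows "quot.is_subspace (\<pi> ` U)"
proof (rule quot.subspaceI)
  show "\<pi> ` U \<subseteq> carrier (lie_quot L I)"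
    using subspace_subset[OF U] by (auto simp: quot_carrier)
  show "\<zero>\<^bsub>lie_quot L I\<^esub> \<in> \<pi> ` U"
    using subspace_zero[OF U] proj_zero by (auto simp: quot_zero)
qed (use subspace_carrierD[OF U] subspace_add[OF U] subspace_smult[OF U] in
  \<open>auto simp: quot_add quot_smult\<close>)

lemma image_ideal:
  assumes "lie_ideal K J L"
  shows "lie_ideal K (\<pi> ` J) (lie_quot L I)"
  using image_subspace[OF ideal_subspace[OF assms]] ideal_carrierD[OF assms] ideal_bracket[OF assms]
  by (auto intro!: quot.lie_idealI simp: quot_carrier quot_bracket)

lemma image_subalgebra:
  assumes "lie_subalgebra K S L"
  shows "lie_subalgebra K (\<pi> ` S) (lie_quot L I)"
  using image_subspace[OF subalgebra_subspace[OF assms]]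
    subspace_carrierD[OF subalgebra_subspace[OF assms]] subalgebra_bracket[OF assms]
  by (auto simp: lie_subalgebra_def quot_bracket)

lemma mem_quot_preimage: "x \<in> quot_preimage L I C \<longleftrightarrow> x \<in> carrier L \<and> \<pi> x \<in> C"
  by (simp add: quot_preimage_def)

lemma image_quot_preimage: "C \<subseteq> carrier (lie_quot L I) \<Longrightarrow> \<pi> ` quot_preimage L I C = C"
  by (auto simp: quot_preimage_def quot_carrier)

lemma ideal_subset_quot_preimage:
  assumes "quot.is_subspace C"
  shows "I \<subseteq> quot_preimage L I C"
proof
  fix x assume "x \<in> I"
  then have "x \<in> carrier L" "\<pi> x = I"
    using ideal_carrierD[OF ideal] proj_eq_zero_iff by auto
  then show "x \<in> quot_preimage L I C"
    using quot.subspace_zero[OF assms] by (simp add: mem_quot_preimage quot_zero)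
qed

lemma preimage_subspace:
  assumes C: "quot.is_subspace C"
  shows "is_subspace (quot_preimage L I C)"
  using quot.subspace_zero[OF C] quot.subspace_add[OF C] quot.subspace_smult[OF C]
  by (auto intro!: subspaceI simp: mem_quot_preimage proj_zero quot_zero quot_add[symmetric]
      quot_smult[symmetric])

lemma preimage_subalgebra:
  assumes "lie_subalgebra K C (lie_quot L I)"
  shows "lie_subalgebra K (quot_preimage L I C) L"
  using preimage_subspace[OF quot.subalgebra_subspace[OF assms]] quot.subalgebra_bracket[OF assms]
  by (auto simp: lie_subalgebra_def mem_quot_preimage bracket_closed quot_bracket[symmetric])

lemma quot_preimage_image:
  assumes "is_subspace U" "I \<subseteq> U"
  shows "quot_preimage L I (\<pi> ` U) = U"
  unfolding quot_preimage_def using mem_image_proj_iff[OF assms] subspace_subset[OF assms(1)] by blast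

text \<open>A larger subalgebra of the quotient is pulled back to L, where maximality of M applies.
  The inclusion \<open>I \<subseteq> M\<close> keeps the image of M proper.\<close>

lemma maximal_subalgebra_image:
  assumes M: "maximal_subalgebra K M L" and IM: "I \<subseteq> M"
  shows "maximal_subalgebra K (\<pi> ` M) (lie_quot L I)"
  unfolding maximal_subalgebra_def
proof (intro conjI allI impI)
  have Ms: "lie_subalgebra K M L" "is_subspace M"
    using M subalgebra_subspace by (auto simp: maximal_subalgebra_def)
  show "lie_subalgebra K (\<pi> ` M) (lie_quot L I)"
    using image_subalgebra Ms by blast
  show "\<pi> ` M \<noteq> carrier (lie_quot L I)"
  proof
    assume "\<pi> ` M = carrier (lie_quot L I)"
    then have "\<And>x. x \<in> carrier L \<Longrightarrow> x \<in> M"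
      using mem_image_proj_iff[OF Ms(2) IM] by (auto simp: quot_carrier)
    then show False
      using M subspace_subset[OF Ms(2)] by (auto simp: maximal_subalgebra_def)
  qed
  fix S assume S: "lie_subalgebra K S (lie_quot L I) \<and> \<pi> ` M \<subseteq> S"
  have Sc: "S \<subseteq> carrier (lie_quot L I)"
    using S quot.subspace_subset[OF quot.subalgebra_subspace] by blast
  have "M \<subseteq> quot_preimage L I S"
    unfolding quot_preimage_def using S subspace_subset[OF Ms(2)] by blast
  then have "quot_preimage L I S = M \<or> quot_preimage L I S = carrier L"
    using M preimage_subalgebra[of S] S by (auto simp: maximal_subalgebra_def)
  then show "S = \<pi> ` M \<or> S = carrier (lie_quot L I)"
    using image_quot_preimage[OF Sc] quot_carrier by metis
qed

lemma maximal_subalgebra_preimage: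
  assumes N: "maximal_subalgebra K N (lie_quot L I)"
  shows "maximal_subalgebra K (quot_preimage L I N) L"
  unfolding maximal_subalgebra_def
proof (intro conjI allI impI)
  have Ns: "lie_subalgebra K N (lie_quot L I)" "quot.is_subspace N"
    using N quot.subalgebra_subspace by (auto simp: maximal_subalgebra_def)
  show "lie_subalgebra K (quot_preimage L I N) L"
    using preimage_subalgebra Ns by blast
  have im: "\<pi> ` quot_preimage L I N = N"
    using image_quot_preimage quot.subspace_subset[OF Ns(2)] by blast
  then show "quot_preimage L I N \<noteq> carrier L"
    using N quot_carrier by (auto simp: maximal_subalgebra_def)
  fix S assume S: "lie_subalgebra K S L \<and> quot_preimage L I N \<subseteq> S"
  then have Ss: "is_subspace S" "I \<subseteq> S"
    using subalgebra_subspace ideal_subset_quot_preimage[OF Ns(2)] by blast+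
  have "N \<subseteq> \<pi> ` S"
    using S im by blast
  then have "\<pi> ` S = N \<or> \<pi> ` S = carrier (lie_quot L I)"
    using N image_subalgebra S by (auto simp: maximal_subalgebra_def)
  then show "S = quot_preimage L I N \<or> S = carrier L"
    using quot_preimage_image[OF Ss] quot_preimage_image[OF subspace_carrier ideal_subset[OF ideal]]
      quot_carrier by metis
qed

text \<open>Maximal subalgebras of the quotient correspond to those of L containing I. Thus
  \<open>frattini_series\<close> can be computed with subalgebras of L alone.\<close>

lemma quot_preimage_frattini:
  "quot_preimage L I (frattini K (lie_quot L I)) =
     {x \<in> carrier L. \<forall>M. maximal_subalgebra K M L \<and> I \<subseteq> M \<longrightarrow> x \<in> M}"
proof -
  have "(\<forall>N. maximal_subalgebra K N (lie_quot L I) \<longrightarrow> \<pi> x \<in> N) \<longleftrightarrow>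
    (\<forall>M. maximal_subalgebra K M L \<and> I \<subseteq> M \<longrightarrow> x \<in> M)" if x: "x \<in> carrier L" for x
  proof (intro iffI allI impI)
    fix M assume *: "\<forall>N. maximal_subalgebra K N (lie_quot L I) \<longrightarrow> \<pi> x \<in> N"
      and M: "maximal_subalgebra K M L \<and> I \<subseteq> M"
    then have "\<pi> x \<in> \<pi> ` M"
      using maximal_subalgebra_image by blast
    then show "x \<in> M"
      using mem_image_proj_iff[of M x] x M subalgebra_subspace by (auto simp: maximal_subalgebra_def)
  next
    fix N assume *: "\<forall>M. maximal_subalgebra K M L \<and> I \<subseteq> M \<longrightarrow> x \<in> M"
      and N: "maximal_subalgebra K N (lie_quot L I)"
    have "I \<subseteq> quot_preimage L I N"
      using N quot.subalgebra_subspace ideal_subset_quot_preimage by (auto simp: maximal_subalgebra_def)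
    then show "\<pi> x \<in> N"
      using * maximal_subalgebra_preimage[OF N] mem_quot_preimage by blast
  qed
  then show ?thesis
    by (simp add: frattini_def quot_preimage_def quot_carrier cong: conj_cong)
qed

lemma ad_pow_proj:
  assumes "x \<in> carrier L" "y \<in> carrier L"
  shows "quot.ad_pow n (\<pi> x) (\<pi> y) = \<pi> (ad_pow n x y)"
  using assms by (induction n) (auto simp: quot_bracket)

lemma image_adjoin:
  assumes "is_subspace U" "e \<in> carrier L"
  shows "\<pi> ` adjoin U e = quot.adjoin (\<pi> ` U) (\<pi> e)"
proof -
  have "\<pi> (u \<oplus>\<^bsub>L\<^esub> t \<odot>\<^bsub>L\<^esub> e) = \<pi> u \<oplus>\<^bsub>lie_quot L I\<^esub> t \<odot>\<^bsub>lie_quot L I\<^esub> \<pi> e"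
    if "u \<in> U" "t \<in> carrier K" for u t
    using that assms by (simp add: quot_add quot_smult subspace_carrierD)
  then show ?thesis
    unfolding adjoin_def quot.adjoin_def by (auto simp: image_iff) (metis | blast)+
qed

lemma quot_fin_dim:
  assumes "fin_dim"
  shows "quot.fin_dim"
proof -
  interpret proj_map: linear_map K L "lie_quot L I" proj
    by unfold_locales (auto simp: module_hom_def quot_carrier quot_add quot_smult)
  show ?thesis
    using proj_map.rank_nullity_main(2)[OF assms] quot_carrier by simp
qed

lemma image_proj_self: "\<pi> ` I = {\<zero>\<^bsub>lie_quot L I\<^esub>}"
proof -
  have "\<pi> x = I" if "x \<in> I" for x
    using that proj_eq_zero_iff ideal_carrierD[OF ideal] by blast
  then show ?thesis
    using subspace_zero[OF subspace_I] unfolding quot_zero by blast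
qed

end

section \<open>The nilradical of a Lie algebra with a flag of ideals\<close>

context lie_algebra
begin

text \<open>Nilpotency of \<open>ad x\<close> vector by vector: the exponent may depend on
  \<open>y\<close>, which is exactly what a null component equal to L provides. With a flag of
  length m, the exponent m works for every y.\<close>

definition ad_nil :: "'b set"
  where "ad_nil = {x \<in> carrier L. \<forall>y\<in>carrier L. \<exists>n. ad_pow n x y = \<zero>\<^bsub>L\<^esub>}"

lemma bracket_adjoin_subset:
  assumes B: "lie_ideal K B L" and e: "e \<in> carrier L" and x: "x \<in> carrier L"
    and xe: "\<langle>x, e\<rangle>\<^bsub>L\<^esub> \<in> B" and v: "v \<in> adjoin B e"
  shows "\<langle>x, v\<rangle>\<^bsub>L\<^esub> \<in> B"
proof -
  obtain b t where "b \<in> B" "t \<in> carrier K" "v = b \<oplus>\<^bsub>L\<^esub> t \<odot>\<^bsub>L\<^esub> e"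
    using v by (rule adjoinE)
  then have "\<langle>x, v\<rangle>\<^bsub>L\<^esub> = \<langle>x, b\<rangle>\<^bsub>L\<^esub> \<oplus>\<^bsub>L\<^esub> t \<odot>\<^bsub>L\<^esub> \<langle>x, e\<rangle>\<^bsub>L\<^esub>"
    using x e ideal_carrierD[OF B] by (simp add: bracket_add_right bracket_smult_right)
  then show ?thesis
    using ideal_bracket[OF B x \<open>b \<in> B\<close>] subspace_smult[OF ideal_subspace[OF B] \<open>t \<in> carrier K\<close> xe]
      subspace_add[OF ideal_subspace[OF B]] by simp
qed

lemma bracket_adjoinE:
  assumes B: "lie_ideal K B L" and A: "lie_ideal K (adjoin B e) L" and e: "e \<in> carrier L"
    and x: "x \<in> carrier L"
  obtains b a where "b \<in> B" "a \<in> carrier K" "\<langle>x, e\<rangle>\<^bsub>L\<^esub> = b \<oplus>\<^bsub>L\<^esub> a \<odot>\<^bsub>L\<^esub> e"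
  using ideal_bracket[OF A x adjoin_mem[OF ideal_subspace[OF B] e]] adjoinE by metis

text \<open>The algebra of endomorphisms of a one-dimensional space is commutative.\<close>

lemma derived_bracket_adjoin:
  assumes B: "lie_ideal K B L" and A: "lie_ideal K (adjoin B e) L" and e: "e \<in> carrier L"
    and x: "x \<in> carrier L" and y: "y \<in> carrier L" and v: "v \<in> adjoin B e"
  shows "\<langle>\<langle>x, y\<rangle>\<^bsub>L\<^esub>, v\<rangle>\<^bsub>L\<^esub> \<in> B"
proof (rule bracket_adjoin_subset[OF B e bracket_closed[OF x y] _ v])
  note Bs = ideal_subspace[OF B]
  note [simp] = ideal_carrierD[OF B]
  obtain b a where xe: "b \<in> B" "a \<in> carrier K" "\<langle>x, e\<rangle>\<^bsub>L\<^esub> = b \<oplus>\<^bsub>L\<^esub> a \<odot>\<^bsub>L\<^esub> e"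
    using B A e x by (rule bracket_adjoinE)
  obtain c d where ye: "c \<in> B" "d \<in> carrier K" "\<langle>y, e\<rangle>\<^bsub>L\<^esub> = c \<oplus>\<^bsub>L\<^esub> d \<odot>\<^bsub>L\<^esub> e"
    using B A e y by (rule bracket_adjoinE)
  define p q where "p = \<langle>x, c\<rangle>\<^bsub>L\<^esub> \<oplus>\<^bsub>L\<^esub> d \<odot>\<^bsub>L\<^esub> b" and "q = \<langle>y, b\<rangle>\<^bsub>L\<^esub> \<oplus>\<^bsub>L\<^esub> a \<odot>\<^bsub>L\<^esub> c"
  have pq: "p \<in> B" "q \<in> B"
    using xe ye x y unfolding p_def q_def
    by (auto intro!: subspace_add[OF Bs] subspace_smult[OF Bs] ideal_bracket[OF B])
  have 1: "\<langle>x, \<langle>y, e\<rangle>\<^bsub>L\<^esub>\<rangle>\<^bsub>L\<^esub> = p \<oplus>\<^bsub>L\<^esub> (a \<otimes> d) \<odot>\<^bsub>L\<^esub> e"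
    unfolding ye(3) p_def using xe(1,2) ye(1,2) x y e bracket_closed
    by (simp add: bracket_add_right bracket_smult_right xe(3) smult_r_distr smult_assoc1[symmetric]
        M.a_assoc R.m_comm)
  have 2: "\<langle>y, \<langle>x, e\<rangle>\<^bsub>L\<^esub>\<rangle>\<^bsub>L\<^esub> = q \<oplus>\<^bsub>L\<^esub> (a \<otimes> d) \<odot>\<^bsub>L\<^esub> e"
    unfolding xe(3) q_def using xe(1,2) ye(1,2) x y e bracket_closed
    by (simp add: bracket_add_right bracket_smult_right ye(3) smult_r_distr smult_assoc1[symmetric]
        M.a_assoc)
  have "\<langle>\<langle>x, y\<rangle>\<^bsub>L\<^esub>, e\<rangle>\<^bsub>L\<^esub> = p \<ominus>\<^bsub>L\<^esub> q"
    unfolding bracket_bracket_left[OF x y e] 1 2 using pq xe(2) ye(2) e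
    by (simp add: a_minus_def M.minus_add M.a_ac M.r_neg M.r_neg1 M.r_neg2)
  then show "\<langle>\<langle>x, y\<rangle>\<^bsub>L\<^esub>, e\<rangle>\<^bsub>L\<^esub> \<in> B"
    using subspace_minus[OF Bs pq] by simp
qed

text \<open>On the factor (B + F e)/B the element x acts by a scalar. Were it nonzero, each
  application would multiply the coefficient of e by it, and no power could bring e into B.\<close>

lemma nilpotent_bracket_adjoin:
  assumes B: "lie_ideal K B L" and A: "lie_ideal K (adjoin B e) L" and e: "e \<in> carrier L"
    and x: "x \<in> carrier L" and nil: "ad_pow n x e \<in> B" and v: "v \<in> adjoin B e"
  shows "\<langle>x, v\<rangle>\<^bsub>L\<^esub> \<in> B"
proof (rule bracket_adjoin_subset[OF B e x _ v], rule ccontr)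
  note Bs = ideal_subspace[OF B]
  assume xe: "\<langle>x, e\<rangle>\<^bsub>L\<^esub> \<notin> B"
  obtain b a where ba: "b \<in> B" "a \<in> carrier K" "\<langle>x, e\<rangle>\<^bsub>L\<^esub> = b \<oplus>\<^bsub>L\<^esub> a \<odot>\<^bsub>L\<^esub> e"
    using B A e x by (rule bracket_adjoinE)
  have a: "a \<noteq> \<zero>"
    using xe ba e ideal_carrierD[OF B] by auto
  have eB: "e \<notin> B"
    using xe ideal_bracket[OF B x] by blast
  have "ad_pow k x e \<in> adjoin B e \<and> ad_pow k x e \<notin> B" for k
  proof (induction k)
    case 0
    then show ?case using adjoin_mem[OF Bs e] eB by simp
  next
    case (Suc k)
    let ?u = "ad_pow k x e"
    obtain c t where u: "c \<in> B" "t \<in> carrier K" "?u = c \<oplus>\<^bsub>L\<^esub> t \<odot>\<^bsub>L\<^esub> e"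
      using Suc adjoinE by metis
    then have t: "t \<noteq> \<zero>"
      using Suc e ideal_carrierD[OF B] by auto
    have "\<langle>x, ?u\<rangle>\<^bsub>L\<^esub> = (\<langle>x, c\<rangle>\<^bsub>L\<^esub> \<oplus>\<^bsub>L\<^esub> t \<odot>\<^bsub>L\<^esub> b) \<oplus>\<^bsub>L\<^esub> t \<odot>\<^bsub>L\<^esub> (a \<odot>\<^bsub>L\<^esub> e)"
      unfolding u(3) using u(1,2) ba(1,2) x e ideal_carrierD[OF B] bracket_closed
      by (simp add: bracket_add_right bracket_smult_right ba(3) smult_r_distr M.a_assoc del: smult_assoc_simp)
    moreover have "\<langle>x, c\<rangle>\<^bsub>L\<^esub> \<oplus>\<^bsub>L\<^esub> t \<odot>\<^bsub>L\<^esub> b \<in> B"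
      using u ba x by (auto intro!: subspace_add[OF Bs] subspace_smult[OF Bs] ideal_bracket[OF B])
    ultimately have "\<langle>x, ?u\<rangle>\<^bsub>L\<^esub> \<notin> B"
      using subspace_add_cancel_left[OF Bs] subspace_smult_cancel[OF Bs] t u(2) a ba(2) e eB
      by (metis smult_closed)
    then show ?case
      using ideal_bracket[OF A x] Suc by simp
  qed
  then show False using nil by blast
qed

lemma lower_central_subset:
  assumes "lie_subalgebra K J L"
  shows "lower_central K (vs J) n \<subseteq> J"
proof (induction n)
  case (Suc n)
  interpret J: vectorspace K "vs J"
    using subspace_is_vs[OF subalgebra_subspace[OF assms]] .
  have "{\<langle>x, y\<rangle>\<^bsub>L\<^esub> | x y. x \<in> J \<and> y \<in> lower_central K (vs J) n} \<subseteq> J"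
    using Suc subalgebra_bracket[OF assms] by blast
  then show ?case
    using J.span_is_subset2[of "{\<langle>x, y\<rangle>\<^bsub>L\<^esub> | x y. x \<in> J \<and> y \<in> lower_central K (vs J) n}"] by simp
qed simp

text \<open>The series of J is defined by spans inside J; taking them in L makes the subspaces of L
  usable as upper bounds.\<close>

lemma lower_central_Suc_span:
  assumes "lie_subalgebra K J L"
  shows "lower_central K (vs J) (Suc n) =
    span {\<langle>x, y\<rangle>\<^bsub>L\<^esub> | x y. x \<in> J \<and> y \<in> lower_central K (vs J) n}"
proof -
  have "{\<langle>x, y\<rangle>\<^bsub>L\<^esub> | x y. x \<in> J \<and> y \<in> lower_central K (vs J) n} \<subseteq> J"
    using lower_central_subset[OF assms] subalgebra_bracket[OF assms] by blast
  from span_li_not_depend(1)[OF this is_module[OF subalgebra_subspace[OF assms]]]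
  show ?thesis by simp
qed

lemma nilpotent_ideal_subset_ad_nil:
  assumes J: "lie_ideal K J L" and nil: "lie_nilpotent K (vs J)"
  shows "J \<subseteq> ad_nil"
proof
  fix x assume x: "x \<in> J"
  note Js = ideal_subalgebra[OF J]
  obtain n where n: "lower_central K (vs J) n = {\<zero>\<^bsub>L\<^esub>}"
    using nil by (auto simp: lie_nilpotent_def)
  \<comment> \<open>The shift by one: y is arbitrary, so the first bracket is spent on entering J,
    which is term 0 of the series.\<close>
  have "ad_pow (Suc k) x y \<in> lower_central K (vs J) k" if y: "y \<in> carrier L" for k y
  proof (induction k)
    case 0
    then show ?case using ideal_bracket_left[OF J y x] by simp
  next
    case (Suc k)
    let ?S = "{\<langle>x, y\<rangle>\<^bsub>L\<^esub> | x y. x \<in> J \<and> y \<in> lower_central K (vs J) k}"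
    have "?S \<subseteq> carrier L"
      using lower_central_subset[OF Js] subalgebra_bracket[OF Js] ideal_subset[OF J] by blast
    moreover have "ad_pow (Suc (Suc k)) x y \<in> ?S"
      using Suc x by auto
    ultimately show ?case
      unfolding lower_central_Suc_span[OF Js] using in_own_span by blast
  qed
  then show "x \<in> ad_nil"
    using n ideal_carrierD[OF J x] unfolding ad_nil_def by blast
qed

end

text \<open>Consecutive terms of the flag may coincide, so that flags pass to quotients.\<close>

locale flagged_lie_algebra = lie_algebra +
  fixes m :: nat and I :: "nat \<Rightarrow> 'c set"
  assumes flag_zero: "I 0 = {\<zero>\<^bsub>L\<^esub>}" and flag_top: "I m = carrier L"
    and flag_ideal: "j \<le> m \<Longrightarrow> lie_ideal K (I j) L"
    and flag_step: "j < m \<Longrightarrow> \<exists>e\<in>carrier L. I (Suc j) = adjoin (I j) e"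
begin

text \<open>Nilpotency makes every scalar by which x acts on a factor vanish; conversely, m steps
  down the flag reach 0. The right-hand side is linear in x, which gives closure under addition, a
  property that sums of nilpotent maps do not have in general.\<close>

lemma ad_nil_eq: "ad_nil = {x \<in> carrier L. \<forall>j<m. \<forall>v\<in>I (Suc j). \<langle>x, v\<rangle>\<^bsub>L\<^esub> \<in> I j}"
proof (intro equalityI subsetI)
  fix x assume "x \<in> ad_nil"
  then have x: "x \<in> carrier L" and nil: "\<And>y. y \<in> carrier L \<Longrightarrow> \<exists>n. ad_pow n x y = \<zero>\<^bsub>L\<^esub>"
    by (auto simp: ad_nil_def)
  have "\<langle>x, v\<rangle>\<^bsub>L\<^esub> \<in> I j" if j: "j < m" and v: "v \<in> I (Suc j)" for j v
  proof -
    obtain e where e: "e \<in> carrier L" "I (Suc j) = adjoin (I j) e"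
      using flag_step[OF j] by blast
    obtain n where "ad_pow n x e = \<zero>\<^bsub>L\<^esub>"
      using nil[OF e(1)] by blast
    then have "ad_pow n x e \<in> I j"
      using subspace_zero[OF ideal_subspace[OF flag_ideal]] j by simp
    moreover have "lie_ideal K (I j) L" "lie_ideal K (adjoin (I j) e) L"
      using flag_ideal[of j] flag_ideal[of "Suc j"] j e by auto
    ultimately show ?thesis
      using nilpotent_bracket_adjoin[OF _ _ e(1) x] v e(2) by blast
  qed
  then show "x \<in> {x \<in> carrier L. \<forall>j<m. \<forall>v\<in>I (Suc j). \<langle>x, v\<rangle>\<^bsub>L\<^esub> \<in> I j}"
    using x by blast
next
  fix x assume "x \<in> {x \<in> carrier L. \<forall>j<m. \<forall>v\<in>I (Suc j). \<langle>x, v\<rangle>\<^bsub>L\<^esub> \<in> I j}"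
  then have x: "x \<in> carrier L" and down: "\<And>j v. j < m \<Longrightarrow> v \<in> I (Suc j) \<Longrightarrow> \<langle>x, v\<rangle>\<^bsub>L\<^esub> \<in> I j"
    by auto
  have "ad_pow k x y \<in> I (m - k)" if "y \<in> carrier L" "k \<le> m" for y k
    using that(2)
  proof (induction k)
    case 0
    then show ?case using that flag_top by simp
  next
    case (Suc k)
    then have "ad_pow k x y \<in> I (Suc (m - Suc k))"
      by (simp add: Suc_diff_Suc)
    then show ?case
      using down[of "m - Suc k"] Suc.prems by simp
  qed
  from this[of _ m] show "x \<in> ad_nil"
    using x flag_zero unfolding ad_nil_def by auto
qed

lemma derived_in_ad_nil:
  assumes "x \<in> carrier L" "y \<in> carrier L"
  shows "\<langle>x, y\<rangle>\<^bsub>L\<^esub> \<in> ad_nil"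
proof -
  have "\<langle>\<langle>x, y\<rangle>\<^bsub>L\<^esub>, v\<rangle>\<^bsub>L\<^esub> \<in> I j" if j: "j < m" and v: "v \<in> I (Suc j)" for j v
  proof -
    obtain e where e: "e \<in> carrier L" "I (Suc j) = adjoin (I j) e"
      using flag_step[OF j] by blast
    moreover have "lie_ideal K (I j) L" "lie_ideal K (adjoin (I j) e) L"
      using flag_ideal[of j] flag_ideal[of "Suc j"] j e by auto
    ultimately show ?thesis
      using derived_bracket_adjoin[OF _ _ e(1) assms] v by blast
  qed
  then show ?thesis
    unfolding ad_nil_eq using assms bracket_closed by blast
qed

lemma ad_nil_subspace: "is_subspace ad_nil"
proof (rule subspaceI)
  have S: "is_subspace (I j)" if "j < m" for j
    using ideal_subspace flag_ideal that by simp
  have c: "v \<in> carrier L" if "j < m" "v \<in> I (Suc j)" for j v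
    using ideal_carrierD[OF flag_ideal, of "Suc j" v] that by simp
  show "\<zero>\<^bsub>L\<^esub> \<in> ad_nil"
    unfolding ad_nil_eq using S c by (auto simp: subspace_zero)
  show "v \<oplus>\<^bsub>L\<^esub> w \<in> ad_nil" if "v \<in> ad_nil" "w \<in> ad_nil" for v w
    using that unfolding ad_nil_eq using S c by (auto simp: bracket_add_left intro!: subspace_add)
  show "a \<odot>\<^bsub>L\<^esub> v \<in> ad_nil" if "a \<in> carrier K" "v \<in> ad_nil" for a v
    using that unfolding ad_nil_eq using S c by (auto simp: bracket_smult_left intro!: subspace_smult)
qed (auto simp: ad_nil_def)

text \<open>Any subspace containing the derived algebra is an ideal.\<close>

lemma ad_nil_ideal: "lie_ideal K ad_nil L"
  using ad_nil_subspace derived_in_ad_nil by (auto intro!: lie_idealI simp: ad_nil_def)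

text \<open>Each bracket with an element of \<open>ad_nil\<close> moves one step down the flag, so
  the flag bounds the lower central series.\<close>

lemma ad_nil_nilpotent: "lie_nilpotent K (vs ad_nil)"
proof -
  note Ns = ideal_subalgebra[OF ad_nil_ideal]
  have "lower_central K (vs ad_nil) k \<subseteq> I (m - k)" if "k \<le> m" for k
    using that
  proof (induction k)
    case 0
    then show ?case using flag_top by (auto simp: ad_nil_def)
  next
    case (Suc k)
    then have "lower_central K (vs ad_nil) k \<subseteq> I (Suc (m - Suc k))"
      by (simp add: Suc_diff_Suc)
    then have "{\<langle>x, y\<rangle>\<^bsub>L\<^esub> | x y. x \<in> ad_nil \<and> y \<in> lower_central K (vs ad_nil) k} \<subseteq> I (m - Suc k)"
      using Suc.prems unfolding ad_nil_eq by fastforce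
    then show ?case
      unfolding lower_central_Suc_span[OF Ns]
      by (rule span_is_subset) (simp add: flag_ideal ideal_subspace)
  qed
  from this[of m] have "lower_central K (vs ad_nil) m \<subseteq> {\<zero>\<^bsub>L\<^esub>}"
    using flag_zero by simp
  \<comment> \<open>Equality with {0} also needs nonemptiness. Term 0 is the whole subalgebra and
    the later terms are spans, hence the two cases.\<close>
  moreover have "\<zero>\<^bsub>L\<^esub> \<in> lower_central K (vs ad_nil) m"
  proof (cases m)
    case 0
    then show ?thesis using subspace_zero[OF ad_nil_subspace] by simp
  next
    case (Suc k)
    show ?thesis
      unfolding Suc lower_central_Suc_span[OF Ns] by (rule span_zero)
  qed
  ultimately show ?thesis
    by (auto simp: lie_nilpotent_def)
qed

text \<open>Every nilpotent ideal acts nilpotently on L, and \<open>ad_nil\<close> is itself one of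
  the ideals whose sum is taken.\<close>

lemma nilradical_eq_ad_nil: "nilradical K L = ad_nil"
proof
  let ?S = "\<Union>{J. lie_ideal K J L \<and> lie_nilpotent K (vs J)}"
  have "?S \<subseteq> ad_nil"
    using nilpotent_ideal_subset_ad_nil by blast
  then show "nilradical K L \<subseteq> ad_nil"
    unfolding nilradical_def by (rule span_is_subset) (simp add: ad_nil_subspace)
  have "?S \<subseteq> carrier L"
    using ideal_subset by blast
  then show "ad_nil \<subseteq> nilradical K L"
    unfolding nilradical_def using in_own_span ad_nil_ideal ad_nil_nilpotent by blast
qed

lemma flag_quotient:
  assumes "lie_ideal K J L"
  shows "flagged_lie_algebra K (lie_quot L J) m (\<lambda>j. (\<lambda>x. J +>\<^bsub>L\<^esub> x) ` I j)"
proof -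
  interpret lie_quotient K L J
    using lie_quotientI[OF assms] .
  show ?thesis
  proof unfold_locales
    show "(\<lambda>x. J +>\<^bsub>L\<^esub> x) ` I 0 = {\<zero>\<^bsub>lie_quot L J\<^esub>}"
      using proj_zero by (simp add: flag_zero quot_zero)
    show "(\<lambda>x. J +>\<^bsub>L\<^esub> x) ` I m = carrier (lie_quot L J)"
      by (simp add: flag_top quot_carrier)
    fix j
    show "lie_ideal K ((\<lambda>x. J +>\<^bsub>L\<^esub> x) ` I j) (lie_quot L J)" if "j \<le> m"
      using image_ideal flag_ideal[OF that] .
    show "\<exists>e\<in>carrier (lie_quot L J).
      (\<lambda>x. J +>\<^bsub>L\<^esub> x) ` I (Suc j) = quot.adjoin ((\<lambda>x. J +>\<^bsub>L\<^esub> x) ` I j) e" if j: "j < m"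
    proof -
      obtain e where e: "e \<in> carrier L" "I (Suc j) = adjoin (I j) e"
        using flag_step[OF j] by blast
      then have "(\<lambda>x. J +>\<^bsub>L\<^esub> x) ` I (Suc j) = quot.adjoin ((\<lambda>x. J +>\<^bsub>L\<^esub> x) ` I j) (J +>\<^bsub>L\<^esub> e)"
        using image_adjoin[OF ideal_subspace[OF flag_ideal] e(1)] j by simp
      then show ?thesis
        using e(1) by (auto simp: quot_carrier)
    qed
  qed
qed

text \<open>The flag descends to L/J, so the description by \<open>ad_nil\<close> holds there too
  and pulls back to nilpotency modulo J.\<close>

lemma nilradical_quot_preimage:
  assumes "lie_ideal K J L"
  shows "quot_preimage L J (nilradical K (lie_quot L J)) =
    {x \<in> carrier L. \<forall>y\<in>carrier L. \<exists>n. ad_pow n x y \<in> J}"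
proof -
  interpret lie_quotient K L J
    using lie_quotientI[OF assms] .
  interpret Q: flagged_lie_algebra K "lie_quot L J" m "\<lambda>j. (\<lambda>x. J +>\<^bsub>L\<^esub> x) ` I j"
    using flag_quotient[OF assms] .
  show ?thesis
    unfolding Q.nilradical_eq_ad_nil quot.ad_nil_def quot_preimage_def
    by (simp add: quot_carrier ad_pow_proj quot_zero proj_eq_zero_iff cong: conj_cong)
qed

lemma upper_nilpotent_1: "upper_nilpotent K L 1 = ad_nil"
  using nilradical_quot_preimage[OF trivial_ideal] by (simp add: ad_nil_def)

text \<open>One bracket already lands in \<open>ad_nil\<close>. Hence the nilpotent length is at
  most two, and at most two factors matter for \<open>extreme\<close>.\<close>

lemma upper_nilpotent_2: "upper_nilpotent K L 2 = carrier L"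
proof -
  have "\<exists>n. ad_pow n x y \<in> ad_nil" if "x \<in> carrier L" "y \<in> carrier L" for x y
    using derived_in_ad_nil[OF that] by (intro exI[of _ 1]) simp
  then have "quot_preimage L ad_nil (nilradical K (lie_quot L ad_nil)) = carrier L"
    unfolding nilradical_quot_preimage[OF ad_nil_ideal] by blast
  then show ?thesis
    using upper_nilpotent_1 by (simp add: numeral_2_eq_2)
qed

end

section \<open>The Frattini subalgebra\<close>

context lie_algebra
begin

text \<open>The generalised eigenspace of \<open>ad x\<close> for the eigenvalue 0, that is, its
  Fitting null component.\<close>

definition ad_null :: "'b \<Rightarrow> 'b set"
  where "ad_null x = {y \<in> carrier L. \<exists>n. ad_pow n x y = \<zero>\<^bsub>L\<^esub>}"

lemma ad_pow_add:
  assumes "x \<in> carrier L" "y \<in> carrier L" "z \<in> carrier L"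
  shows "ad_pow n x (y \<oplus>\<^bsub>L\<^esub> z) = ad_pow n x y \<oplus>\<^bsub>L\<^esub> ad_pow n x z"
  using assms by (induction n) (simp_all add: bracket_add_right)

lemma ad_pow_smult:
  assumes "x \<in> carrier L" "y \<in> carrier L" "a \<in> carrier K"
  shows "ad_pow n x (a \<odot>\<^bsub>L\<^esub> y) = a \<odot>\<^bsub>L\<^esub> ad_pow n x y"
  using assms by (induction n) (simp_all add: bracket_smult_right)

lemma ad_pow_minus:
  assumes "x \<in> carrier L" "y \<in> carrier L" "z \<in> carrier L"
  shows "ad_pow n x (y \<ominus>\<^bsub>L\<^esub> z) = ad_pow n x y \<ominus>\<^bsub>L\<^esub> ad_pow n x z"
  using assms by (induction n) (simp_all add: bracket_minus_right)

lemma ad_pow_zero: "x \<in> carrier L \<Longrightarrow> ad_pow n x \<zero>\<^bsub>L\<^esub> = \<zero>\<^bsub>L\<^esub>"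
  by (induction n) simp_all

lemma ad_pow_eq_zero_mono:
  assumes "x \<in> carrier L" "ad_pow n x y = \<zero>\<^bsub>L\<^esub>"
  shows "ad_pow (k + n) x y = \<zero>\<^bsub>L\<^esub>"
  using assms by (simp add: funpow_add ad_pow_zero)

lemma ad_null_subspace:
  assumes x: "x \<in> carrier L"
  shows "is_subspace (ad_null x)"
proof (rule subspaceI)
  show "\<zero>\<^bsub>L\<^esub> \<in> ad_null x"
    using ad_pow_zero[OF x] by (auto simp: ad_null_def)
  fix v w assume "v \<in> ad_null x" "w \<in> ad_null x"
  then obtain n k where v: "v \<in> carrier L" "ad_pow n x v = \<zero>\<^bsub>L\<^esub>" and w: "w \<in> carrier L" "ad_pow k x w = \<zero>\<^bsub>L\<^esub>"
    by (auto simp: ad_null_def)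
  have "ad_pow (k + n) x (v \<oplus>\<^bsub>L\<^esub> w) = \<zero>\<^bsub>L\<^esub>"
    using ad_pow_eq_zero_mono[OF x v(2), of k] ad_pow_eq_zero_mono[OF x w(2), of n] x v(1) w(1)
    by (simp add: ad_pow_add add.commute)
  then show "v \<oplus>\<^bsub>L\<^esub> w \<in> ad_null x"
    using v w by (auto simp: ad_null_def)
next
  fix a v assume "a \<in> carrier K" "v \<in> ad_null x"
  then show "a \<odot>\<^bsub>L\<^esub> v \<in> ad_null x"
    using x ad_pow_smult[of x v a] by (auto simp: ad_null_def) (metis rmult_0)
qed (auto simp: ad_null_def)

lemma bracket_in_ad_nullD:
  assumes "x \<in> carrier L" "y \<in> carrier L" "\<langle>x, y\<rangle>\<^bsub>L\<^esub> \<in> ad_null x"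
  shows "y \<in> ad_null x"
proof -
  obtain n where "ad_pow n x \<langle>x, y\<rangle>\<^bsub>L\<^esub> = \<zero>\<^bsub>L\<^esub>"
    using assms(3) by (auto simp: ad_null_def)
  then have "ad_pow (Suc n) x y = \<zero>\<^bsub>L\<^esub>"
    by (simp add: funpow_swap1)
  then show ?thesis
    using assms(2) unfolding ad_null_def by blast
qed

text \<open>The Leibniz rule without binomial coefficients: \<open>ad x\<close> is a derivation, so
  [x, [y, z]] is a sum of two brackets in each of which one exponent has dropped. By induction on p
  + q it lies in the null component, and then so does [y, z].\<close>

lemma ad_null_subalgebra:
  assumes x: "x \<in> carrier L"
  shows "lie_subalgebra K (ad_null x) L"
proof -
  have "\<langle>y, z\<rangle>\<^bsub>L\<^esub> \<in> ad_null x"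
    if "y \<in> carrier L" "z \<in> carrier L" "ad_pow p x y = \<zero>\<^bsub>L\<^esub>" "ad_pow q x z = \<zero>\<^bsub>L\<^esub>" for y z p q
    using that
  proof (induction "p + q" arbitrary: y z p q)
    case 0
    then show ?case using subspace_zero[OF ad_null_subspace[OF x]] by simp
  next
    case (Suc k)
    show ?case
    proof (cases "p = 0 \<or> q = 0")
      case True
      then show ?thesis
        using Suc.prems subspace_zero[OF ad_null_subspace[OF x]] by auto
    next
      case False
      then obtain p' q' where pq: "p = Suc p'" "q = Suc q'"
        by (metis not0_implies_Suc)
      have "\<langle>\<langle>x, y\<rangle>\<^bsub>L\<^esub>, z\<rangle>\<^bsub>L\<^esub> \<in> ad_null x"
        using Suc.hyps(1)[of p' q "\<langle>x, y\<rangle>\<^bsub>L\<^esub>" z] Suc.hyps(2) Suc.prems pq x bracket_closed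
        by (simp add: funpow_swap1)
      moreover have "\<langle>y, \<langle>x, z\<rangle>\<^bsub>L\<^esub>\<rangle>\<^bsub>L\<^esub> \<in> ad_null x"
        using Suc.hyps(1)[of p q' y "\<langle>x, z\<rangle>\<^bsub>L\<^esub>"] Suc.hyps(2) Suc.prems pq x bracket_closed
        by (simp add: funpow_swap1)
      ultimately have "\<langle>x, \<langle>y, z\<rangle>\<^bsub>L\<^esub>\<rangle>\<^bsub>L\<^esub> \<in> ad_null x"
        using bracket_derivation[OF x] Suc.prems subspace_add[OF ad_null_subspace[OF x]] by simp
      then show ?thesis
        using bracket_in_ad_nullD[OF x] Suc.prems bracket_closed by blast
    qed
  qed
  then show ?thesis
    using ad_null_subspace[OF x] by (auto simp: lie_subalgebra_def ad_null_def)
qed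

lemma ad_pow_image_subspace:
  assumes x: "x \<in> carrier L"
  shows "is_subspace (ad_pow n x ` carrier L)"
proof (rule subspaceI)
  show "\<zero>\<^bsub>L\<^esub> \<in> ad_pow n x ` carrier L"
    using ad_pow_zero[OF x] M.zero_closed by (metis imageI)
qed (use x in \<open>auto simp: ad_pow_add[symmetric] ad_pow_smult[symmetric]\<close>)

text \<open>The exponent k is prescribed so that the second summand falls into any subspace known to
  contain the image of the k-th power.\<close>

lemma fitting_decomposition:
  assumes fd: "fin_dim" and x: "x \<in> carrier L" and y: "y \<in> carrier L"
  obtains u v where "u \<in> ad_null x" "v \<in> carrier L" "y = u \<oplus>\<^bsub>L\<^esub> ad_pow k x v"
proof -
  let ?W = "\<lambda>n. ad_pow n x ` carrier L"
  let ?d = "\<lambda>n. vectorspace.dim K (vs (?W n))"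
  note S = ad_pow_image_subspace[OF x]
  have desc: "?W (n + p) \<subseteq> ?W n" for n p
    using x by (auto simp: funpow_add)
  \<comment> \<open>The images of the powers decrease, so from an image of least dimension onwards
    they are constant.\<close>
  obtain n where n: "\<And>p. ?d n \<le> ?d p"
    using ex_has_least_nat[of "\<lambda>_. True" 0 ?d] by blast
  have "?W (n + p) = ?W n" for p
    using dim_strict_mono[OF fd S S, of "n + p" n] desc[of n p] n[of "n + p"] by auto
  \<comment> \<open>Past stabilisation the power k + n and its double have the same image; a
    preimage v under the double makes y - (ad x)^(k + n) v null.\<close>
  then have eq: "?W (k + n) = ?W ((k + n) + (k + n))"
    by (metis add.assoc add.commute)
  obtain v where v: "v \<in> carrier L" "ad_pow (k + n) x y = ad_pow ((k + n) + (k + n)) x v"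
    using eq y by blast
  let ?w = "ad_pow (k + n) x v"
  have "ad_pow (k + n) x (y \<ominus>\<^bsub>L\<^esub> ?w) = \<zero>\<^bsub>L\<^esub>"
    using x y v by (simp add: ad_pow_minus funpow_add)
  moreover have "y \<ominus>\<^bsub>L\<^esub> ?w \<in> carrier L"
    using x y v(1) by simp
  ultimately have "y \<ominus>\<^bsub>L\<^esub> ?w \<in> ad_null x"
    unfolding ad_null_def by blast
  moreover have "y = (y \<ominus>\<^bsub>L\<^esub> ?w) \<oplus>\<^bsub>L\<^esub> ad_pow k x (ad_pow n x v)"
    using x y v(1) by (simp add: a_minus_def M.a_assoc M.l_neg funpow_add)
  ultimately show thesis
    using that x v(1) ad_pow_closed by blast
qed

section \<open>Maximal subalgebras and nongenerators\<close>

lemma frattini_subspace: "is_subspace (frattini K L)"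
  by (rule subspaceI)
    (auto simp: frattini_def maximal_subalgebra_def lie_subalgebra_def subspace_zero subspace_add subspace_smult)

lemma exists_maximal_subalgebra:
  assumes fd: "fin_dim" and S: "lie_subalgebra K S L" "S \<noteq> carrier L"
  obtains M where "maximal_subalgebra K M L" "S \<subseteq> M"
proof -
  let ?P = "\<lambda>U. lie_subalgebra K U L \<and> U \<noteq> carrier L"
  show thesis
  proof (rule exists_maximal_subspace[OF fd, of ?P S])
    show "?P S" using S by simp
    show "is_subspace U" if "?P U" for U using that subalgebra_subspace by blast
    fix M assume "?P M" "S \<subseteq> M" "\<And>U. ?P U \<Longrightarrow> M \<subseteq> U \<Longrightarrow> U = M"
    then show thesis
      by (intro that[of M]) (auto simp: maximal_subalgebra_def)
  qed
qed

text \<open>A proper S would lie in a maximal subalgebra, which contains \<open>frattini K L\<close>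
  as well and so could not be proper.\<close>

lemma frattini_nongenerator:
  assumes fd: "fin_dim" and S: "lie_subalgebra K S L"
    and sum: "\<And>x. x \<in> carrier L \<Longrightarrow> \<exists>s\<in>S. \<exists>p\<in>frattini K L. x = s \<oplus>\<^bsub>L\<^esub> p"
  shows "S = carrier L"
proof (rule ccontr)
  assume "S \<noteq> carrier L"
  then obtain M where M: "maximal_subalgebra K M L" "S \<subseteq> M"
    using exists_maximal_subalgebra[OF fd S] by blast
  have Ms: "is_subspace M"
    using M(1) subalgebra_subspace by (auto simp: maximal_subalgebra_def)
  have "x \<in> M" if "x \<in> carrier L" for x
    using sum[OF that] M subspace_add[OF Ms] by (auto simp: frattini_def)
  then show False
    using M(1) subspace_subset[OF Ms] by (auto simp: maximal_subalgebra_def)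
qed

text \<open>Barnes: the Fitting null component of \<open>ad x\<close> is a subalgebra supplementing the Frattini
  subalgebra, hence it is everything.\<close>

lemma ad_nil_if_nilpotent_mod_frattini:
  assumes fd: "fin_dim" and x: "x \<in> carrier L"
    and nil: "\<And>y. y \<in> carrier L \<Longrightarrow> ad_pow k x y \<in> frattini K L"
  shows "x \<in> ad_nil"
proof -
  have "ad_null x = carrier L"
  proof (rule frattini_nongenerator[OF fd ad_null_subalgebra[OF x]])
    fix y assume "y \<in> carrier L"
    with fd x obtain u v where "u \<in> ad_null x" "v \<in> carrier L" "y = u \<oplus>\<^bsub>L\<^esub> ad_pow k x v"
      by (rule fitting_decomposition)
    then show "\<exists>s\<in>ad_null x. \<exists>p\<in>frattini K L. y = s \<oplus>\<^bsub>L\<^esub> p"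
      using nil by blast
  qed
  then show ?thesis
    using x unfolding ad_null_def ad_nil_def by blast
qed

lemma frattini_ideal_subset_ad_nil:
  assumes "fin_dim" "lie_ideal K (frattini K L) L"
  shows "frattini K L \<subseteq> ad_nil"
proof
  fix x assume x: "x \<in> frattini K L"
  have "ad_pow 1 x y \<in> frattini K L" if "y \<in> carrier L" for y
    using ideal_bracket_left[OF assms(2) that x] by simp
  then show "x \<in> ad_nil"
    using ad_nil_if_nilpotent_mod_frattini[OF assms(1) ideal_carrierD[OF assms(2) x]] by blast
qed

lemma adjoin_carrier_maximal:
  assumes M: "lie_subalgebra K M L" and e: "e \<in> carrier L" "e \<notin> M" and top: "adjoin M e = carrier L"
  shows "maximal_subalgebra K M L"
  using assms subspace_between_adjoin[OF subalgebra_subspace[OF M] e(1)] subalgebra_subspace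
    subspace_subset[OF subalgebra_subspace]
  unfolding maximal_subalgebra_def by metis

text \<open>As [e, e] = 0, the only new brackets are those of S with e.\<close>

lemma adjoin_subalgebra:
  assumes S: "lie_subalgebra K S L" and e: "e \<in> carrier L"
    and br: "\<And>x. x \<in> S \<Longrightarrow> \<langle>x, e\<rangle>\<^bsub>L\<^esub> \<in> adjoin S e"
  shows "lie_subalgebra K (adjoin S e) L"
proof -
  note Ss = subalgebra_subspace[OF S] and As = subspace_adjoin[OF subalgebra_subspace[OF S] e]
  note [simp] = subspace_carrierD[OF Ss]
  have "\<langle>u, v\<rangle>\<^bsub>L\<^esub> \<in> adjoin S e" if uA: "u \<in> adjoin S e" and vA: "v \<in> adjoin S e" for u v
  proof -
    obtain x s where u: "x \<in> S" "s \<in> carrier K" "u = x \<oplus>\<^bsub>L\<^esub> s \<odot>\<^bsub>L\<^esub> e"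
      using uA by (rule adjoinE)
    obtain y t where v: "y \<in> S" "t \<in> carrier K" "v = y \<oplus>\<^bsub>L\<^esub> t \<odot>\<^bsub>L\<^esub> e"
      using vA by (rule adjoinE)
    have "\<langle>u, v\<rangle>\<^bsub>L\<^esub> = \<langle>x, y\<rangle>\<^bsub>L\<^esub> \<oplus>\<^bsub>L\<^esub> (t \<odot>\<^bsub>L\<^esub> \<langle>x, e\<rangle>\<^bsub>L\<^esub> \<oplus>\<^bsub>L\<^esub> s \<odot>\<^bsub>L\<^esub> (\<ominus>\<^bsub>L\<^esub> \<langle>y, e\<rangle>\<^bsub>L\<^esub>))"
      unfolding u(3) v(3) using u(1,2) v(1,2) e bracket_closed bracket_self[OF e]
        bracket_antisym[of y e]
      by (simp add: bracket_add_left bracket_add_right bracket_smult_left bracket_smult_right M.a_ac)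
    moreover have "\<langle>x, y\<rangle>\<^bsub>L\<^esub> \<in> adjoin S e"
      using subalgebra_bracket[OF S u(1) v(1)] adjoin_subset[OF Ss e] by blast
    ultimately show ?thesis
      using br u v by (auto intro!: subspace_add[OF As] subspace_smult[OF As] subspace_neg[OF As])
  qed
  then show ?thesis
    using As by (auto simp: lie_subalgebra_def)
qed

end

section \<open>The Frattini subalgebra is an ideal\<close>

context flagged_lie_algebra
begin

text \<open>The first flag term whose intersection with D leaves C exceeds its predecessor by at
  most one dimension. Hence that intersection lies in C + F e, and since it is an ideal, C + F e is
  one too.\<close>

lemma exists_one_dim_step:
  assumes C: "lie_ideal K C L" and D: "lie_ideal K D L" and ex: "\<not> D \<subseteq> C"
  obtains e where "e \<in> D" "e \<notin> C" "lie_ideal K (adjoin C e) L"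
proof -
  note Cs = ideal_subspace[OF C] and Ds = ideal_subspace[OF D]
  let ?Q = "\<lambda>j. j \<le> m \<and> \<not> I j \<inter> D \<subseteq> C"
  define j where "j = (LEAST j. ?Q j)"
  have "?Q m" using ex flag_top ideal_subset[OF D] by auto
  then have j: "?Q j" and least: "\<And>i. i < j \<Longrightarrow> \<not> ?Q i"
    unfolding j_def by (rule LeastI, use not_less_Least in blast)
  have "j \<noteq> 0"
    using j flag_zero subspace_zero[OF Cs] by auto
  then obtain i where i: "j = Suc i" by (metis not0_implies_Suc)
  have Ii: "is_subspace (I i)" "I i \<inter> D \<subseteq> C"
    using least[of i] i j ideal_subspace[OF flag_ideal[of i]] by auto
  obtain e where e: "e \<in> I (Suc i)" "e \<in> D" "e \<notin> C"
    using j i by blast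
  obtain e0 where e0: "e0 \<in> carrier L" "I (Suc i) = adjoin (I i) e0"
    using flag_step[of i] j i by auto
  have ec: "e \<in> carrier L"
    using ideal_carrierD[OF D e(2)] .
  \<comment> \<open>An element of D outside C cannot lie in \<open>I i\<close>, so e may replace the
    given generator \<open>e0\<close>.\<close>
  have step: "I (Suc i) = adjoin (I i) e"
    using adjoin_exchange[OF Ii(1) e0(1), of e] e e0(2) Ii(2) by blast
  have sub: "I (Suc i) \<inter> D \<subseteq> adjoin C e"
  proof
    fix v assume v: "v \<in> I (Suc i) \<inter> D"
    then obtain w t where w: "w \<in> I i" "t \<in> carrier K" "v = w \<oplus>\<^bsub>L\<^esub> t \<odot>\<^bsub>L\<^esub> e"
      unfolding step by (metis IntD1 adjoinE)
    have wc: "w \<in> carrier L"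
      using subspace_carrierD[OF Ii(1) w(1)] .
    have "t \<odot>\<^bsub>L\<^esub> e \<in> D" "v \<in> D"
      using v e(2) w(2) subspace_smult[OF Ds] by auto
    \<comment> \<open>Subtracting t e from v stays inside D, so w lies in
      \<open>I i \<inter> D\<close> and therefore in C.\<close>
    then have "w \<in> D"
      using subspace_add_cancel_left[OF Ds, of "t \<odot>\<^bsub>L\<^esub> e" w] w(3) wc ec w(2) by (simp add: M.a_comm)
    then show "v \<in> adjoin C e"
      using w Ii(2) by (auto intro: adjoinI)
  qed
  have "\<langle>x, e\<rangle>\<^bsub>L\<^esub> \<in> adjoin C e" if "x \<in> carrier L" for x
    using sub ideal_bracket[OF D that e(2)] ideal_bracket[OF flag_ideal[of "Suc i"] that e(1)] j i by auto
  then show thesis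
    using that[OF e(2,3)] adjoin_ideal[OF C ec] by blast
qed

text \<open>A maximal subalgebra \<open>M\<close> with largest ideal \<open>C\<close> is complemented by a chief factor
  \<open>(C + F e)/C\<close>; its image under \<open>1 - ad e\<close>, which is an automorphism modulo \<open>C\<close>, is again
  maximal, and the elements common to both lie in an ideal contained in \<open>M\<close>.\<close>

lemma frattini_subset_ideal:
  assumes fd: "fin_dim" and M: "maximal_subalgebra K M L"
  obtains J where "lie_ideal K J L" "frattini K L \<subseteq> J" "J \<subseteq> M"
proof -
  have Msub: "lie_subalgebra K M L" and Mne: "M \<noteq> carrier L"
    using M by (auto simp: maximal_subalgebra_def)
  note Ms = subalgebra_subspace[OF Msub]
  let ?P = "\<lambda>C. lie_ideal K C L \<and> C \<subseteq> M"
  have "?P {\<zero>\<^bsub>L\<^esub>}"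
    using trivial_ideal subspace_zero[OF Ms] by blast
  \<comment> \<open>Modulo this C, the core of M, no nonzero ideal is contained in M.\<close>
  then obtain C where C: "lie_ideal K C L" "C \<subseteq> M" and Cmax: "\<And>S. ?P S \<Longrightarrow> C \<subseteq> S \<Longrightarrow> S = C"
    using exists_maximal_subspace[OF fd, of ?P "{\<zero>\<^bsub>L\<^esub>}"] ideal_subspace by metis
  note Cs = ideal_subspace[OF C(1)]
  have "\<not> carrier L \<subseteq> C"
    using C(2) Mne subspace_subset[OF Ms] by blast
  with C(1) carrier_ideal obtain e where e: "e \<in> carrier L" "e \<notin> C"
    and A: "lie_ideal K (adjoin C e) L"
    by (rule exists_one_dim_step)
  have CA: "C \<subseteq> adjoin C e" "e \<in> adjoin C e"
    using adjoin_subset[OF Cs e(1)] adjoin_mem[OF Cs e(1)] by auto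
  have eM: "e \<notin> M"
  proof
    assume "e \<in> M"
    then have "adjoin C e \<subseteq> M"
      using adjoin_minimal[OF Ms C(2)] by blast
    then show False
      using Cmax[of "adjoin C e"] A CA e(2) by blast
  qed
  have Abr: "\<langle>x, e\<rangle>\<^bsub>L\<^esub> \<in> adjoin C e" "\<langle>e, x\<rangle>\<^bsub>L\<^esub> \<in> adjoin C e" if "x \<in> carrier L" for x
    using ideal_bracket[OF A that CA(2)] ideal_bracket_left[OF A that CA(2)] by auto
  have AM: "adjoin C e \<subseteq> adjoin M e"
    using C(2) by (auto simp: adjoin_def)
  \<comment> \<open>[M, e] lies in C + F e and hence in M + F e; maximality of M then forces M + F e
    = L.\<close>
  have "lie_subalgebra K (adjoin M e) L"
    using adjoin_subalgebra[OF Msub e(1)] Abr(1) AM subspace_carrierD[OF Ms] by blast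
  then have top: "adjoin M e = carrier L"
    using M adjoin_subset[OF Ms e(1)] adjoin_mem[OF Ms e(1)] eM
    unfolding maximal_subalgebra_def by blast
  \<comment> \<open>The factor (C + F e)/C is at most one-dimensional, hence abelian.\<close>
  have AA: "\<langle>u, v\<rangle>\<^bsub>L\<^esub> \<in> C" if u: "u \<in> adjoin C e" and v: "v \<in> adjoin C e" for u v
  proof (rule bracket_adjoin_subset[OF C(1) e(1) ideal_carrierD[OF A u] _ v])
    obtain c t where "c \<in> C" "t \<in> carrier K" "u = c \<oplus>\<^bsub>L\<^esub> t \<odot>\<^bsub>L\<^esub> e"
      using u by (rule adjoinE)
    then have "\<langle>u, e\<rangle>\<^bsub>L\<^esub> = \<langle>c, e\<rangle>\<^bsub>L\<^esub>"
      using e(1) ideal_carrierD[OF C(1)] bracket_closed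
      by (simp add: bracket_add_left bracket_smult_left bracket_self)
    then show "\<langle>u, e\<rangle>\<^bsub>L\<^esub> \<in> C"
      using ideal_bracket_left[OF C(1) e(1) \<open>c \<in> C\<close>] by simp
  qed
  \<comment> \<open>The preimage of M under 1 + ad e. It is the image under 1 - ad e modulo C,
    because (ad e)^2 maps L into C.\<close>
  define M' where "M' = {x \<in> carrier L. x \<oplus>\<^bsub>L\<^esub> \<langle>e, x\<rangle>\<^bsub>L\<^esub> \<in> M}"
  have M's: "is_subspace M'"
  proof (rule subspaceI)
    show "\<zero>\<^bsub>L\<^esub> \<in> M'"
      using e(1) subspace_zero[OF Ms] by (simp add: M'_def)
    fix v w assume vw: "v \<in> M'" "w \<in> M'"
    then have "(v \<oplus>\<^bsub>L\<^esub> \<langle>e, v\<rangle>\<^bsub>L\<^esub>) \<oplus>\<^bsub>L\<^esub> (w \<oplus>\<^bsub>L\<^esub> \<langle>e, w\<rangle>\<^bsub>L\<^esub>) \<in> M"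
      using subspace_add[OF Ms] by (simp add: M'_def)
    then show "v \<oplus>\<^bsub>L\<^esub> w \<in> M'"
      using vw e(1) bracket_closed by (simp add: M'_def bracket_add_right M.a_ac)
  next
    fix a v assume av: "a \<in> carrier K" "v \<in> M'"
    then have "a \<odot>\<^bsub>L\<^esub> (v \<oplus>\<^bsub>L\<^esub> \<langle>e, v\<rangle>\<^bsub>L\<^esub>) \<in> M"
      using subspace_smult[OF Ms] by (simp add: M'_def)
    then show "a \<odot>\<^bsub>L\<^esub> v \<in> M'"
      using av e(1) bracket_closed by (simp add: M'_def bracket_smult_right smult_r_distr)
  qed (auto simp: M'_def)
  have M'sub: "lie_subalgebra K M' L"
  proof -
    have "\<langle>x, y\<rangle>\<^bsub>L\<^esub> \<in> M'" if "x \<in> M'" "y \<in> M'" for x y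
    proof -
      have xy: "x \<in> carrier L" "x \<oplus>\<^bsub>L\<^esub> \<langle>e, x\<rangle>\<^bsub>L\<^esub> \<in> M" "y \<in> carrier L" "y \<oplus>\<^bsub>L\<^esub> \<langle>e, y\<rangle>\<^bsub>L\<^esub> \<in> M"
        using that by (auto simp: M'_def)
      note [simp] = bracket_closed[OF e(1) xy(1)] bracket_closed[OF e(1) xy(3)]
      \<comment> \<open>This term alone prevents 1 + ad e from preserving brackets; both entries lie
        in C + F e, so \<open>AA\<close> puts it into C.\<close>
      have "\<langle>\<langle>e, x\<rangle>\<^bsub>L\<^esub>, \<langle>e, y\<rangle>\<^bsub>L\<^esub>\<rangle>\<^bsub>L\<^esub> \<in> M"
        using AA Abr(2) xy C(2) by blast
      moreover have "\<langle>x \<oplus>\<^bsub>L\<^esub> \<langle>e, x\<rangle>\<^bsub>L\<^esub>, y \<oplus>\<^bsub>L\<^esub> \<langle>e, y\<rangle>\<^bsub>L\<^esub>\<rangle>\<^bsub>L\<^esub> \<in> M"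
        using subalgebra_bracket[OF Msub] xy by blast
      moreover have "\<langle>x \<oplus>\<^bsub>L\<^esub> \<langle>e, x\<rangle>\<^bsub>L\<^esub>, y \<oplus>\<^bsub>L\<^esub> \<langle>e, y\<rangle>\<^bsub>L\<^esub>\<rangle>\<^bsub>L\<^esub> =
        \<langle>\<langle>e, x\<rangle>\<^bsub>L\<^esub>, \<langle>e, y\<rangle>\<^bsub>L\<^esub>\<rangle>\<^bsub>L\<^esub> \<oplus>\<^bsub>L\<^esub> (\<langle>x, y\<rangle>\<^bsub>L\<^esub> \<oplus>\<^bsub>L\<^esub> \<langle>e, \<langle>x, y\<rangle>\<^bsub>L\<^esub>\<rangle>\<^bsub>L\<^esub>)"
        unfolding bracket_derivation[OF e(1) xy(1,3)] using xy(1,3) e(1) bracket_closed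
        by (simp add: bracket_add_left bracket_add_right M.a_ac)
      ultimately have "\<langle>x, y\<rangle>\<^bsub>L\<^esub> \<oplus>\<^bsub>L\<^esub> \<langle>e, \<langle>x, y\<rangle>\<^bsub>L\<^esub>\<rangle>\<^bsub>L\<^esub> \<in> M"
        using subspace_add_cancel_left[OF Ms] e(1) xy(1,3) bracket_closed M.a_closed by metis
      then show ?thesis
        using xy(1,3) bracket_closed by (simp add: M'_def)
    qed
    then show ?thesis using M's by (simp add: lie_subalgebra_def)
  qed
  have "e \<notin> M'"
    using eM e(1) bracket_self[OF e(1)] by (simp add: M'_def)
  moreover have "carrier L \<subseteq> adjoin M' e"
  proof
    fix x assume x: "x \<in> carrier L"
    then have "x \<oplus>\<^bsub>L\<^esub> \<langle>e, x\<rangle>\<^bsub>L\<^esub> \<in> adjoin M e"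
      using top e(1) bracket_closed by simp
    then obtain w t where w: "w \<in> M" "t \<in> carrier K" "x \<oplus>\<^bsub>L\<^esub> \<langle>e, x\<rangle>\<^bsub>L\<^esub> = w \<oplus>\<^bsub>L\<^esub> t \<odot>\<^bsub>L\<^esub> e"
      by (rule adjoinE)
    \<comment> \<open>Since 1 + ad e fixes e, removing t e from x removes the same t e from x +
      [e, x] and leaves w in M.\<close>
    define z where "z = x \<ominus>\<^bsub>L\<^esub> t \<odot>\<^bsub>L\<^esub> e"
    have wc: "w \<in> carrier L" using subspace_carrierD[OF Ms w(1)] .
    have "\<langle>e, z\<rangle>\<^bsub>L\<^esub> = \<langle>e, x\<rangle>\<^bsub>L\<^esub> \<ominus>\<^bsub>L\<^esub> \<zero>\<^bsub>L\<^esub>"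
      using x w(2) e(1) bracket_self[OF e(1)] unfolding z_def
      by (simp add: bracket_minus_right bracket_smult_right)
    also have "\<dots> = \<langle>e, x\<rangle>\<^bsub>L\<^esub>"
      using x e(1) bracket_closed M.minus_equality[of "\<zero>\<^bsub>L\<^esub>" "\<zero>\<^bsub>L\<^esub>"] by (simp add: a_minus_def)
    finally have "\<langle>e, z\<rangle>\<^bsub>L\<^esub> = \<langle>e, x\<rangle>\<^bsub>L\<^esub>" .
    then have "z \<oplus>\<^bsub>L\<^esub> \<langle>e, z\<rangle>\<^bsub>L\<^esub> = (x \<oplus>\<^bsub>L\<^esub> \<langle>e, x\<rangle>\<^bsub>L\<^esub>) \<ominus>\<^bsub>L\<^esub> t \<odot>\<^bsub>L\<^esub> e"
      using x w(2) e(1) bracket_closed unfolding z_def by (simp add: a_minus_def M.a_ac)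
    also have "\<dots> = w"
      unfolding w(3) using wc w(2) e(1) by (simp add: a_minus_def M.a_assoc M.r_neg)
    finally have "z \<in> M'"
      using w x e(1) by (simp add: M'_def z_def)
    moreover have "x = z \<oplus>\<^bsub>L\<^esub> t \<odot>\<^bsub>L\<^esub> e"
      using x w(2) e(1) by (simp add: z_def a_minus_def M.a_assoc M.l_neg)
    ultimately show "x \<in> adjoin M' e"
      using w(2) adjoinI by blast
  qed
  ultimately have M'max: "maximal_subalgebra K M' L"
    using adjoin_carrier_maximal[OF M'sub e(1)] subspace_subset[OF subspace_adjoin[OF M's e(1)]] by blast
  \<comment> \<open>The elements of M that centralise the factor (C + F e)/C.\<close>
  define J where "J = {x \<in> M. \<langle>e, x\<rangle>\<^bsub>L\<^esub> \<in> C}"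
  have Jc: "x \<in> carrier L" if "x \<in> J" for x
    using that subspace_carrierD[OF Ms] by (simp add: J_def)
  have "frattini K L \<subseteq> J"
  proof
    fix x assume "x \<in> frattini K L"
    then have x: "x \<in> carrier L" "x \<in> M" "x \<oplus>\<^bsub>L\<^esub> \<langle>e, x\<rangle>\<^bsub>L\<^esub> \<in> M"
      using M M'max by (auto simp: frattini_def M'_def)
    \<comment> \<open>So [e, x] lies in both M and C + F e, whose intersection is C because e is
      outside M.\<close>
    then have "\<langle>e, x\<rangle>\<^bsub>L\<^esub> \<in> M"
      using subspace_add_cancel_left[OF Ms x(2)] bracket_closed e(1) by blast
    moreover obtain c t where c: "c \<in> C" "t \<in> carrier K" "\<langle>e, x\<rangle>\<^bsub>L\<^esub> = c \<oplus>\<^bsub>L\<^esub> t \<odot>\<^bsub>L\<^esub> e"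
      using Abr(2)[OF x(1)] by (rule adjoinE)
    ultimately have "t \<odot>\<^bsub>L\<^esub> e \<in> M"
      using subspace_add_cancel_left[OF Ms, of c] C(2) e(1) by auto
    then have "t = \<zero>"
      using subspace_smult_cancel[OF Ms c(2) _ e(1)] eM by blast
    then show "x \<in> J"
      using c e(1) x ideal_carrierD[OF C(1)] by (simp add: J_def)
  qed
  moreover have "lie_ideal K J L"
  proof (rule lie_idealI)
    show Js: "is_subspace J"
    proof (rule subspaceI)
      show "J \<subseteq> carrier L" using Jc by blast
      show "\<zero>\<^bsub>L\<^esub> \<in> J"
        using subspace_zero[OF Ms] subspace_zero[OF Cs] e(1) by (simp add: J_def)
      show "v \<oplus>\<^bsub>L\<^esub> w \<in> J" if "v \<in> J" "w \<in> J" for v w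
        using that Jc[OF that(1)] Jc[OF that(2)] e(1) subspace_add[OF Ms] subspace_add[OF Cs]
        by (simp add: J_def bracket_add_right)
      show "a \<odot>\<^bsub>L\<^esub> v \<in> J" if "a \<in> carrier K" "v \<in> J" for a v
        using that Jc[OF that(2)] e(1) subspace_smult[OF Ms] subspace_smult[OF Cs]
        by (simp add: J_def bracket_smult_right)
    qed
    fix y x assume y: "y \<in> carrier L" and xJ: "x \<in> J"
    then have x: "x \<in> carrier L" "x \<in> M" "\<langle>e, x\<rangle>\<^bsub>L\<^esub> \<in> C"
      using Jc by (auto simp: J_def)
    have eJ: "\<langle>e, x\<rangle>\<^bsub>L\<^esub> \<in> J"
      using x C(2) ideal_bracket[OF C(1) e(1) x(3)] by (auto simp: J_def)
    \<comment> \<open>[e, [w, x]] = [[e, w], x] + [w, [e, x]]: here [e, w] is in C + F e and [e, x]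
      is in C, so both summands lie in C.\<close>
    have wJ: "\<langle>w, x\<rangle>\<^bsub>L\<^esub> \<in> J" if w: "w \<in> M" for w
    proof -
      have wc: "w \<in> carrier L" using subspace_carrierD[OF Ms w] .
      obtain c t where c: "c \<in> C" "t \<in> carrier K" "\<langle>e, w\<rangle>\<^bsub>L\<^esub> = c \<oplus>\<^bsub>L\<^esub> t \<odot>\<^bsub>L\<^esub> e"
        using Abr(2)[OF wc] by (rule adjoinE)
      have "\<langle>\<langle>e, w\<rangle>\<^bsub>L\<^esub>, x\<rangle>\<^bsub>L\<^esub> = \<langle>c, x\<rangle>\<^bsub>L\<^esub> \<oplus>\<^bsub>L\<^esub> t \<odot>\<^bsub>L\<^esub> \<langle>e, x\<rangle>\<^bsub>L\<^esub>"
        unfolding c(3) using c(1,2) x(1) e(1) ideal_carrierD[OF C(1)]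
        by (simp add: bracket_add_left bracket_smult_left)
      then have "\<langle>\<langle>e, w\<rangle>\<^bsub>L\<^esub>, x\<rangle>\<^bsub>L\<^esub> \<in> C"
        using ideal_bracket_left[OF C(1) x(1) c(1)] subspace_smult[OF Cs c(2) x(3)] subspace_add[OF Cs] by simp
      then have "\<langle>e, \<langle>w, x\<rangle>\<^bsub>L\<^esub>\<rangle>\<^bsub>L\<^esub> \<in> C"
        unfolding bracket_derivation[OF e(1) wc x(1)]
        using ideal_bracket[OF C(1) wc x(3)] subspace_add[OF Cs] by blast
      then show ?thesis
        using subalgebra_bracket[OF Msub w x(2)] by (simp add: J_def)
    qed
    obtain w t where w: "w \<in> M" "t \<in> carrier K" "y = w \<oplus>\<^bsub>L\<^esub> t \<odot>\<^bsub>L\<^esub> e"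
      using y top adjoinE by metis
    have "\<langle>y, x\<rangle>\<^bsub>L\<^esub> = \<langle>w, x\<rangle>\<^bsub>L\<^esub> \<oplus>\<^bsub>L\<^esub> t \<odot>\<^bsub>L\<^esub> \<langle>e, x\<rangle>\<^bsub>L\<^esub>"
      unfolding w(3) using w(1,2) x(1) e(1) subspace_carrierD[OF Ms]
      by (simp add: bracket_add_left bracket_smult_left)
    then show "\<langle>y, x\<rangle>\<^bsub>L\<^esub> \<in> J"
      using subspace_add[OF Js wJ[OF w(1)] subspace_smult[OF Js w(2) eJ]] by simp
  qed
  moreover have "J \<subseteq> M" by (auto simp: J_def)
  ultimately show thesis using that by blast
qed

text \<open>Each maximal M is treated separately: y lies in an ideal inside M, and that ideal also
  contains [x, y].\<close>

lemma frattini_ideal: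
  assumes fd: "fin_dim"
  shows "lie_ideal K (frattini K L) L"
proof (rule lie_idealI[OF frattini_subspace])
  fix x y assume x: "x \<in> carrier L" and y: "y \<in> frattini K L"
  have "\<langle>x, y\<rangle>\<^bsub>L\<^esub> \<in> M" if M: "maximal_subalgebra K M L" for M
  proof -
    obtain J where "lie_ideal K J L" "frattini K L \<subseteq> J" "J \<subseteq> M"
      using fd M by (rule frattini_subset_ideal)
    then show ?thesis using ideal_bracket x y by blast
  qed
  then show "\<langle>x, y\<rangle>\<^bsub>L\<^esub> \<in> frattini K L"
    using x y bracket_closed by (simp add: frattini_def)
qed

end

section \<open>Chief factors and extreme algebras\<close>

context lie_algebra
begin

text \<open>With e in \<open>I (Suc j)\<close> outside \<open>I j\<close>, the space I j + F e
  already has dimension j + 1 and so fills \<open>I (Suc j)\<close>.\<close>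

lemma supersolvable_flag:
  assumes fd: "fin_dim" and ss: "supersolvable K L"
  obtains m I where "flagged_lie_algebra K L m I"
proof -
  obtain m and I :: "nat \<Rightarrow> 'b set" where mI: "I 0 = {\<zero>\<^bsub>L\<^esub>}" "I m = carrier L"
    and strict: "\<And>j. j < m \<Longrightarrow> I j \<subset> I (Suc j)"
    and I: "\<And>j. j \<le> m \<Longrightarrow> lie_ideal K (I j) L \<and> vectorspace.dim K (vs (I j)) = j"
    using ss unfolding supersolvable_def by metis
  have "\<exists>e\<in>carrier L. I (Suc j) = adjoin (I j) e" if j: "j < m" for j
  proof -
    have S: "is_subspace (I j)" "is_subspace (I (Suc j))"
      and d: "vectorspace.dim K (vs (I j)) = j" "vectorspace.dim K (vs (I (Suc j))) = Suc j"
      using I[of j] I[of "Suc j"] j ideal_subspace by auto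
    obtain e where e: "e \<in> I (Suc j)" "e \<notin> I j"
      using strict[OF j] by blast
    have ec: "e \<in> carrier L"
      using subspace_carrierD[OF S(2) e(1)] .
    have "adjoin (I j) e \<subseteq> I (Suc j)"
      using adjoin_minimal[OF S(2) _ e(1)] strict[OF j] by blast
    moreover have "\<not> adjoin (I j) e \<subset> I (Suc j)"
      using dim_strict_mono[OF fd subspace_adjoin[OF S(1) ec] S(2)] dim_adjoin[OF fd S(1) ec e(2)] d by auto
    ultimately show ?thesis
      using ec by blast
  qed
  then have "flagged_lie_algebra K L m I"
    using mI I by unfold_locales auto
  then show thesis by (rule that)
qed

text \<open>A smaller ideal of the quotient pulls back to a subspace between B and B + F e, where
  one dimension leaves no room.\<close>

lemma chief_factor_adjoin:
  assumes B: "lie_ideal K B L" and A: "lie_ideal K (adjoin B e) L" and e: "e \<in> carrier L" "e \<notin> B"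
  shows "chief_factor K L (adjoin B e) B"
proof -
  interpret lie_quotient K L B
    using lie_quotientI[OF B] .
  have BA: "B \<subseteq> adjoin B e" "e \<in> adjoin B e"
    using adjoin_subset[OF subspace_I e(1)] adjoin_mem[OF subspace_I e(1)] by auto
  have "minimal_ideal K (proj ` adjoin B e) (lie_quot L B)"
    unfolding minimal_ideal_def
  proof (intro conjI allI impI)
    show "lie_ideal K (proj ` adjoin B e) (lie_quot L B)"
      using image_ideal[OF A] .
    show "proj ` adjoin B e \<noteq> {\<zero>\<^bsub>lie_quot L B\<^esub>}"
      using BA(2) proj_eq_zero_iff[OF e(1)] e(2) by (auto simp: quot_zero)
    fix J assume J: "lie_ideal K J (lie_quot L B) \<and> J \<subseteq> proj ` adjoin B e"
    then have Js: "quot.is_subspace J"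
      using quot.ideal_subspace by blast
    have Jim: "proj ` quot_preimage L B J = J"
      using image_quot_preimage[OF quot.subspace_subset[OF Js]] .
    have "quot_preimage L B J \<subseteq> adjoin B e"
      using J mem_image_proj_iff[OF ideal_subspace[OF A] BA(1)] unfolding quot_preimage_def by blast
    then have "quot_preimage L B J = B \<or> quot_preimage L B J = adjoin B e"
      using subspace_between_adjoin[OF subspace_I e(1) preimage_subspace[OF Js]
          ideal_subset_quot_preimage[OF Js]] by blast
    then show "J = {\<zero>\<^bsub>lie_quot L B\<^esub>} \<or> J = proj ` adjoin B e"
      using Jim image_proj_self by metis
  qed
  then show ?thesis
    using A B BA e(2) unfolding chief_factor_def by blast
qed

lemma chief_factor_between:
  assumes "chief_factor K L A B" "lie_ideal K C L" "B \<subseteq> C" "C \<subseteq> A"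
  shows "C = B \<or> C = A"
proof -
  have A: "lie_ideal K A L" and B: "lie_ideal K B L" and "B \<subset> A"
    and min: "minimal_ideal K ((\<lambda>x. B +>\<^bsub>L\<^esub> x) ` A) (lie_quot L B)"
    using assms(1) by (auto simp: chief_factor_def)
  interpret lie_quotient K L B
    using lie_quotientI[OF B] .
  have "proj ` C = {\<zero>\<^bsub>lie_quot L B\<^esub>} \<or> proj ` C = proj ` A"
    using min image_ideal[OF assms(2)] image_mono[OF assms(4), of proj] by (simp add: minimal_ideal_def)
  then show ?thesis
  proof
    assume "proj ` C = {\<zero>\<^bsub>lie_quot L B\<^esub>}"
    then have "proj x = B" if "x \<in> C" for x
      using that by (auto simp: quot_zero)
    then have "C \<subseteq> B"
      using proj_eq_zero_iff ideal_carrierD[OF assms(2)] by blast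
    then show ?thesis using assms(3) by blast
  next
    assume "proj ` C = proj ` A"
    then have "quot_preimage L B (proj ` C) = quot_preimage L B (proj ` A)"
      by (rule arg_cong)
    then have "C = A"
      unfolding quot_preimage_image[OF ideal_subspace[OF assms(2)] assms(3)]
        quot_preimage_image[OF ideal_subspace[OF A] psubset_imp_subset[OF \<open>B \<subset> A\<close>]] .
    then show ?thesis by (rule disjI2)
  qed
qed

text \<open>The series is defined through L/0, whose elements are cosets. Every maximal subalgebra
  contains 0, so nothing changes.\<close>

lemma frattini_series_1: "frattini_series K L 1 = frattini K L"
proof -
  interpret lie_quotient K L "{\<zero>\<^bsub>L\<^esub>}"
    using lie_quotientI[OF trivial_ideal] .
  have "{\<zero>\<^bsub>L\<^esub>} \<subseteq> M" if "maximal_subalgebra K M L" for M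
    using that subspace_zero subalgebra_subspace by (auto simp: maximal_subalgebra_def)
  then show ?thesis
    using quot_preimage_frattini by (auto simp: frattini_series_def frattini_def)
qed

end

section \<open>The two directions of the equivalence\<close>

context flagged_lie_algebra
begin

lemma chief_factor_ad_nil_imp:
  assumes fd: "fin_dim" and chief: "chief_factor K L ad_nil (frattini K L)"
  shows "dim = 1 \<or> (vectorspace.dim K (lie_quot L (frattini K L)) = 2 \<and>
    \<not> lie_abelian (lie_quot L (frattini K L)))"
proof -
  let ?\<Phi> = "frattini K L"
  have \<Phi>: "lie_ideal K ?\<Phi> L" and less: "?\<Phi> \<subset> ad_nil"
    using chief by (auto simp: chief_factor_def)
  note \<Phi>s = ideal_subspace[OF \<Phi>]
  have "\<not> ad_nil \<subseteq> ?\<Phi>" using less by blast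
  with \<Phi> ad_nil_ideal obtain e where e: "e \<in> ad_nil" "e \<notin> ?\<Phi>"
    and A: "lie_ideal K (adjoin ?\<Phi> e) L"
    by (rule exists_one_dim_step)
  have ec: "e \<in> carrier L" using ideal_carrierD[OF ad_nil_ideal e(1)] .
  have N: "ad_nil = adjoin ?\<Phi> e"
    using chief_factor_between[OF chief A adjoin_subset[OF \<Phi>s ec]]
      adjoin_minimal[OF ad_nil_subspace _ e(1)] adjoin_mem[OF \<Phi>s ec] less e(2) by blast
  \<comment> \<open>The first bracket with y lands in the derived algebra, hence in N = phi(L) + F
    e; the second maps N into phi(L).\<close>
  have cent: "y \<in> ad_nil" if y: "y \<in> carrier L" and ye: "\<langle>y, e\<rangle>\<^bsub>L\<^esub> \<in> ?\<Phi>" for y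
  proof (rule ad_nil_if_nilpotent_mod_frattini[OF fd y])
    fix z assume "z \<in> carrier L"
    then have "\<langle>y, \<langle>y, z\<rangle>\<^bsub>L\<^esub>\<rangle>\<^bsub>L\<^esub> \<in> ?\<Phi>"
      using bracket_adjoin_subset[OF \<Phi> ec y ye] derived_in_ad_nil[OF y] N by blast
    then show "ad_pow 2 y z \<in> ?\<Phi>"
      by (simp add: numeral_2_eq_2)
  qed
  show ?thesis
  proof (cases "ad_nil = carrier L")
    case True
    \<comment> \<open>Now L = phi(L) + F e. The line F e is a subalgebra and phi(L) consists of
      nongenerators, so L = F e.\<close>
    let ?S = "adjoin {\<zero>\<^bsub>L\<^esub>} e"
    have "\<langle>x, e\<rangle>\<^bsub>L\<^esub> \<in> ?S" if "x \<in> {\<zero>\<^bsub>L\<^esub>}" for x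
      using that ec subspace_zero[OF subspace_adjoin[OF subspace_trivial ec]] by simp
    then have S: "lie_subalgebra K ?S L"
      using adjoin_subalgebra[OF ideal_subalgebra[OF trivial_ideal] ec] by blast
    have "?S = carrier L"
    proof (rule frattini_nongenerator[OF fd S])
      fix x assume "x \<in> carrier L"
      then obtain p t where p: "p \<in> ?\<Phi>" "t \<in> carrier K" "x = p \<oplus>\<^bsub>L\<^esub> t \<odot>\<^bsub>L\<^esub> e"
        using True N adjoinE by metis
      moreover have "t \<odot>\<^bsub>L\<^esub> e \<in> ?S"
        using subspace_smult[OF subalgebra_subspace[OF S] p(2) adjoin_mem[OF subspace_trivial ec]] .
      ultimately show "\<exists>s\<in>?S. \<exists>p\<in>?\<Phi>. x = s \<oplus>\<^bsub>L\<^esub> p"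
        using ec ideal_carrierD[OF \<Phi> p(1)] by (metis M.a_comm smult_closed)
    qed
    moreover have "e \<notin> {\<zero>\<^bsub>L\<^esub>}"
      using e(2) subspace_zero[OF \<Phi>s] by auto
    moreover have "vs (carrier L) = L" by simp
    ultimately show ?thesis
      using dim_adjoin[OF fd subspace_trivial ec] dim_trivial by simp
  next
    case False
    then obtain y where y: "y \<in> carrier L" "y \<notin> ad_nil"
      using ideal_subset[OF ad_nil_ideal] by blast
    have ye: "\<langle>y, e\<rangle>\<^bsub>L\<^esub> \<notin> ?\<Phi>" using cent y by blast
    obtain b a where b: "b \<in> ?\<Phi>" "a \<in> carrier K" "\<langle>y, e\<rangle>\<^bsub>L\<^esub> = b \<oplus>\<^bsub>L\<^esub> a \<odot>\<^bsub>L\<^esub> e"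
      using \<Phi> A ec y(1) by (rule bracket_adjoinE)
    have a: "a \<noteq> \<zero>"
      using ye b ec ideal_carrierD[OF \<Phi>] by auto
    have top: "carrier L \<subseteq> adjoin ad_nil y"
    proof
      fix z assume z: "z \<in> carrier L"
      obtain c d where c: "c \<in> ?\<Phi>" "d \<in> carrier K" "\<langle>z, e\<rangle>\<^bsub>L\<^esub> = c \<oplus>\<^bsub>L\<^esub> d \<odot>\<^bsub>L\<^esub> e"
        using \<Phi> A ec z by (rule bracket_adjoinE)
      \<comment> \<open>Modulo phi(L), y and z act on e by the scalars a and d; this s makes z + s y
        act by d + s a = 0, so \<open>cent\<close> applies.\<close>
      define s where "s = \<ominus> (d \<otimes> inv a)"
      have ia: "inv a \<in> carrier K" "inv a \<otimes> a = \<one>"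
        using inverse_exists[OF b(2) a] b(2) a field_Units Units_l_inv by auto
      have s: "s \<in> carrier K" "s \<otimes> a = \<ominus> d"
        using c(2) ia b(2) by (simp_all add: s_def R.l_minus R.m_assoc)
      have "\<langle>z \<oplus>\<^bsub>L\<^esub> s \<odot>\<^bsub>L\<^esub> y, e\<rangle>\<^bsub>L\<^esub> = (c \<oplus>\<^bsub>L\<^esub> d \<odot>\<^bsub>L\<^esub> e) \<oplus>\<^bsub>L\<^esub> (s \<odot>\<^bsub>L\<^esub> b \<oplus>\<^bsub>L\<^esub> (s \<otimes> a) \<odot>\<^bsub>L\<^esub> e)"
        using z y(1) ec s(1) b(1,2) ideal_carrierD[OF \<Phi>]
        by (simp add: bracket_add_left bracket_smult_left b(3) c(3) smult_r_distr smult_assoc1)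
      also have "\<dots> = (c \<oplus>\<^bsub>L\<^esub> s \<odot>\<^bsub>L\<^esub> b) \<oplus>\<^bsub>L\<^esub> (d \<oplus> s \<otimes> a) \<odot>\<^bsub>L\<^esub> e"
        using s(1) b(1,2) c(1,2) ec ideal_carrierD[OF \<Phi>] by (simp add: smult_l_distr M.a_ac)
      also have "\<dots> = c \<oplus>\<^bsub>L\<^esub> s \<odot>\<^bsub>L\<^esub> b"
        unfolding s(2) using s(1) b(1) c(1,2) ec ideal_carrierD[OF \<Phi>] by (simp add: R.r_neg)
      also have "\<dots> \<in> ?\<Phi>"
        using s(1) b(1) c(1) subspace_add[OF \<Phi>s] subspace_smult[OF \<Phi>s] by blast
      finally have N': "z \<oplus>\<^bsub>L\<^esub> s \<odot>\<^bsub>L\<^esub> y \<in> ad_nil"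
        using cent z y(1) s(1) by simp
      have "z = (z \<oplus>\<^bsub>L\<^esub> s \<odot>\<^bsub>L\<^esub> y) \<oplus>\<^bsub>L\<^esub> (\<ominus> s) \<odot>\<^bsub>L\<^esub> y"
        using z y(1) s(1) by (simp add: M.a_assoc smult_l_distr[symmetric] R.r_neg)
      then show "z \<in> adjoin ad_nil y"
        using N' s(1) adjoinI[of "z \<oplus>\<^bsub>L\<^esub> s \<odot>\<^bsub>L\<^esub> y" ad_nil "\<ominus> s" y] by simp
    qed
    interpret lie_quotient K L ?\<Phi>
      using lie_quotientI[OF \<Phi>] .
    note qfd = quot_fin_dim[OF fd]
    note im\<Phi> = image_proj_self
    \<comment> \<open>The chain 0 < N/phi(L) < L/phi(L) has one-dimensional steps, spanned by the
      images of e and y; counting them gives dimension two.\<close>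
    have 1: "quot.adjoin {\<zero>\<^bsub>lie_quot L ?\<Phi>\<^esub>} (proj e) = proj ` ad_nil"
      using image_adjoin[OF \<Phi>s ec] im\<Phi> N by simp
    have 2: "quot.adjoin (proj ` ad_nil) (proj y) = carrier (lie_quot L ?\<Phi>)"
      using image_adjoin[OF ad_nil_subspace y(1)] top
        subspace_subset[OF subspace_adjoin[OF ad_nil_subspace y(1)]] by (simp add: quot_carrier subset_antisym)
    have "proj e \<notin> {\<zero>\<^bsub>lie_quot L ?\<Phi>\<^esub>}"
      using proj_eq_zero_iff[OF ec] e(2) by (simp add: quot_zero)
    then have "vectorspace.dim K (quot.vs (proj ` ad_nil)) = 1"
      using quot.dim_adjoin[OF qfd quot.subspace_trivial, of "proj e"] quot.dim_trivial 1 ec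
      by (simp add: quot_carrier)
    moreover have "proj y \<notin> proj ` ad_nil"
      using mem_image_proj_iff[OF ad_nil_subspace _ y(1)] less y(2) by blast
    moreover have yc: "proj y \<in> carrier (lie_quot L ?\<Phi>)"
      using y(1) by (simp add: quot_carrier)
    ultimately have "quot.dim = 2"
      using quot.dim_adjoin[OF qfd image_subspace[OF ad_nil_subspace] yc] 2 by simp
    moreover have "\<not> lie_abelian (lie_quot L ?\<Phi>)"
    proof
      assume "lie_abelian (lie_quot L ?\<Phi>)"
      then have "proj \<langle>y, e\<rangle>\<^bsub>L\<^esub> = ?\<Phi>"
        using y(1) ec by (auto simp: lie_abelian_def quot_carrier quot_bracket quot_zero)
      then show False
        using ye proj_eq_zero_iff bracket_closed y(1) ec by blast
    qed
    ultimately show ?thesis by blast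
  qed
qed

lemma extreme_imp:
  assumes fd: "fin_dim" and ne: "carrier L \<noteq> {\<zero>\<^bsub>L\<^esub>}" and ext: "extreme K L"
  shows "dim = 1 \<or> (vectorspace.dim K (lie_quot L (frattini K L)) = 2 \<and>
    \<not> lie_abelian (lie_quot L (frattini K L)))"
proof (rule chief_factor_ad_nil_imp[OF fd])
  have "upper_nilpotent K L (nilpotent_length K L) = carrier L"
    unfolding nilpotent_length_def using upper_nilpotent_2 by (rule LeastI)
  \<comment> \<open>For a nonzero algebra the index 1 is therefore in the range over which
    \<open>extreme\<close> quantifies.\<close>
  then have "nilpotent_length K L \<noteq> 0"
    using ne by (metis upper_nilpotent.simps(1))
  then have "1 \<in> {1..nilpotent_length K L}" by simp
  then have "chief_factor K L (upper_nilpotent K L 1) (frattini_series K L 1)"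
    using ext unfolding extreme_def by blast
  then show "chief_factor K L ad_nil (frattini K L)"
    by (simp only: frattini_series_1 upper_nilpotent_1)
qed

text \<open>L = F e is abelian, so N = L; as {0} has codimension one it is a maximal subalgebra, so
  phi(L) = 0. The only factor is L/0.\<close>

lemma extreme_if_dim_1:
  assumes fd: "fin_dim" and ne: "carrier L \<noteq> {\<zero>\<^bsub>L\<^esub>}" and dim: "dim = 1"
  shows "extreme K L"
proof -
  obtain e where e: "e \<in> carrier L" "e \<notin> {\<zero>\<^bsub>L\<^esub>}"
    using ne by blast
  have top: "adjoin {\<zero>\<^bsub>L\<^esub>} e = carrier L"
    using subspace_eq_carrier[OF fd subspace_adjoin[OF subspace_trivial e(1)]]
      dim_adjoin[OF fd subspace_trivial e] dim_trivial dim by simp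
  have xe: "\<langle>x, e\<rangle>\<^bsub>L\<^esub> \<in> {\<zero>\<^bsub>L\<^esub>}" if x: "x \<in> carrier L" for x
  proof -
    have "x \<in> adjoin {\<zero>\<^bsub>L\<^esub>} e" using x top by simp
    then obtain z t where "z \<in> {\<zero>\<^bsub>L\<^esub>}" "t \<in> carrier K" "x = z \<oplus>\<^bsub>L\<^esub> t \<odot>\<^bsub>L\<^esub> e"
      by (rule adjoinE)
    then show ?thesis
      using e(1) bracket_self by (simp add: bracket_smult_left)
  qed
  have "\<langle>x, y\<rangle>\<^bsub>L\<^esub> = \<zero>\<^bsub>L\<^esub>" if "x \<in> carrier L" "y \<in> carrier L" for x y
    using bracket_adjoin_subset[OF trivial_ideal e(1) that(1) xe] that top by blast
  then have "\<exists>n. ad_pow n x y = \<zero>\<^bsub>L\<^esub>" if "x \<in> carrier L" "y \<in> carrier L" for x y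
    using that by (intro exI[of _ 1]) simp
  then have N: "ad_nil = carrier L"
    unfolding ad_nil_def by blast
  have "maximal_subalgebra K {\<zero>\<^bsub>L\<^esub>} L"
    using adjoin_carrier_maximal[OF ideal_subalgebra[OF trivial_ideal] e top] .
  then have \<Phi>: "frattini K L = {\<zero>\<^bsub>L\<^esub>}"
    using subspace_zero[OF frattini_subspace] by (auto simp: frattini_def)
  have "nilpotent_length K L = 1"
    unfolding nilpotent_length_def
  proof (rule Least_equality)
    show "upper_nilpotent K L 1 = carrier L"
      using upper_nilpotent_1 N by simp
    fix n assume n: "upper_nilpotent K L n = carrier L"
    show "1 \<le> n"
      using n ne by (cases n) auto
  qed
  moreover have "chief_factor K L (carrier L) {\<zero>\<^bsub>L\<^esub>}"
    using chief_factor_adjoin[OF trivial_ideal _ e] top carrier_ideal by simp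
  ultimately show ?thesis
    unfolding extreme_def
    using upper_nilpotent_1 N frattini_series_1 \<Phi> by auto
qed

text \<open>The chain phi(L) < phi(L) + F e = N < N + F y = L provides both chief factors.
  Noncommutativity supplies e and keeps y out of N.\<close>

lemma extreme_if_quotient:
  assumes fd: "fin_dim" and dim: "vectorspace.dim K (lie_quot L (frattini K L)) = 2"
    and nab: "\<not> lie_abelian (lie_quot L (frattini K L))"
  shows "extreme K L"
proof -
  let ?\<Phi> = "frattini K L"
  have \<Phi>: "lie_ideal K ?\<Phi> L"
    using frattini_ideal[OF fd] .
  note \<Phi>s = ideal_subspace[OF \<Phi>]
  interpret lie_quotient K L ?\<Phi>
    using lie_quotientI[OF \<Phi>] .
  note qfd = quot_fin_dim[OF fd]
  have abelianI: "lie_abelian (lie_quot L ?\<Phi>)"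
    if "\<And>x y. x \<in> carrier L \<Longrightarrow> y \<in> carrier L \<Longrightarrow> \<langle>x, y\<rangle>\<^bsub>L\<^esub> \<in> ?\<Phi>"
    using that proj_eq_zero_iff bracket_closed
    by (auto simp: lie_abelian_def quot_carrier quot_bracket quot_zero)
  have \<Phi>N: "?\<Phi> \<subseteq> ad_nil"
    using frattini_ideal_subset_ad_nil[OF fd \<Phi>] .
  \<comment> \<open>\<open>ad_nil\<close> contains the derived algebra, which is not inside phi(L)
    because the quotient is not abelian.\<close>
  have "\<not> ad_nil \<subseteq> ?\<Phi>"
    using abelianI nab derived_in_ad_nil by blast
  with \<Phi> ad_nil_ideal obtain e where e: "e \<in> ad_nil" "e \<notin> ?\<Phi>"
    and A: "lie_ideal K (adjoin ?\<Phi> e) L"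
    by (rule exists_one_dim_step)
  have ec: "e \<in> carrier L" using ideal_carrierD[OF ad_nil_ideal e(1)] .
  let ?A = "adjoin ?\<Phi> e"
  note As = ideal_subspace[OF A]
  have \<Phi>A: "?\<Phi> \<subseteq> ?A" "e \<in> ?A"
    using adjoin_subset[OF \<Phi>s ec] adjoin_mem[OF \<Phi>s ec] by auto
  note im\<Phi> = image_proj_self
  have "proj e \<notin> {\<zero>\<^bsub>lie_quot L ?\<Phi>\<^esub>}"
    using proj_eq_zero_iff[OF ec] e(2) by (simp add: quot_zero)
  then have d1: "vectorspace.dim K (quot.vs (proj ` ?A)) = 1"
    using quot.dim_adjoin[OF qfd quot.subspace_trivial, of "proj e"] quot.dim_trivial ec
      image_adjoin[OF \<Phi>s ec] im\<Phi> by (simp add: quot_carrier)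
  have "?A \<noteq> carrier L"
  proof
    assume "?A = carrier L"
    then have "quot.vs (proj ` ?A) = lie_quot L ?\<Phi>"
      using quot_carrier by (simp add: lie_quot_def)
    then show False using d1 dim by simp
  qed
  then obtain y where y: "y \<in> carrier L" "y \<notin> ?A"
    using subspace_subset[OF As] by blast
  \<comment> \<open>Adjoining y to the one-dimensional image fills the two-dimensional quotient;
    pulled back, L = phi(L) + F e + F y.\<close>
  have "proj y \<notin> proj ` ?A"
    using mem_image_proj_iff[OF As \<Phi>A(1) y(1)] y(2) by blast
  then have "vectorspace.dim K (quot.vs (proj ` adjoin ?A y)) = quot.dim"
    using quot.dim_adjoin[OF qfd image_subspace[OF As], of "proj y"] d1 dim image_adjoin[OF As y(1)] y(1)
    by (simp add: quot_carrier)
  then have "proj ` adjoin ?A y = proj ` carrier L"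
    using quot.subspace_eq_carrier[OF qfd image_subspace[OF subspace_adjoin[OF As y(1)]]] quot_carrier
    by simp
  then have top: "adjoin ?A y = carrier L"
    using quot_preimage_image[OF subspace_adjoin[OF As y(1)]] \<Phi>A(1) adjoin_subset[OF As y(1)]
      quot_preimage_image[OF subspace_carrier ideal_subset[OF \<Phi>]] by (metis order_trans)
  \<comment> \<open>Otherwise L/phi(L) would be spanned by two commuting elements and be
    abelian.\<close>
  have ye: "\<langle>y, e\<rangle>\<^bsub>L\<^esub> \<notin> ?\<Phi>"
  proof
    assume "\<langle>y, e\<rangle>\<^bsub>L\<^esub> \<in> ?\<Phi>"
    then have yA: "\<langle>y, v\<rangle>\<^bsub>L\<^esub> \<in> ?\<Phi>" if "v \<in> ?A" for v
      using bracket_adjoin_subset[OF \<Phi> ec y(1) _ that] by blast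
    have ee: "\<langle>e, v\<rangle>\<^bsub>L\<^esub> \<in> ?\<Phi>" if "v \<in> ?A" for v
      using bracket_adjoin_subset[OF \<Phi> ec ec _ that] bracket_self[OF ec] subspace_zero[OF \<Phi>s] by simp
    have AA: "\<langle>u, v\<rangle>\<^bsub>L\<^esub> \<in> ?\<Phi>" if u: "u \<in> ?A" and v: "v \<in> ?A" for u v
    proof (rule bracket_adjoin_subset[OF \<Phi> ec ideal_carrierD[OF A u] _ v])
      show "\<langle>u, e\<rangle>\<^bsub>L\<^esub> \<in> ?\<Phi>"
        using ee[OF u] bracket_antisym[OF ec ideal_carrierD[OF A u]] subspace_neg[OF \<Phi>s] by simp
    qed
    have Ay: "\<langle>u, y\<rangle>\<^bsub>L\<^esub> \<in> ?\<Phi>" if "u \<in> ?A" for u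
      using yA[OF that] bracket_antisym[OF y(1) ideal_carrierD[OF A that]] subspace_neg[OF \<Phi>s] by simp
    have "\<langle>u, v\<rangle>\<^bsub>L\<^esub> \<in> ?\<Phi>" if uc: "u \<in> carrier L" and vc: "v \<in> carrier L" for u v
    proof -
      have "u \<in> adjoin ?A y" "v \<in> adjoin ?A y" using uc vc top by auto
      then obtain a s b t where u: "a \<in> ?A" "s \<in> carrier K" "u = a \<oplus>\<^bsub>L\<^esub> s \<odot>\<^bsub>L\<^esub> y"
        and v: "b \<in> ?A" "t \<in> carrier K" "v = b \<oplus>\<^bsub>L\<^esub> t \<odot>\<^bsub>L\<^esub> y"
        by (metis adjoinE)
      have "\<langle>u, v\<rangle>\<^bsub>L\<^esub> = (\<langle>a, b\<rangle>\<^bsub>L\<^esub> \<oplus>\<^bsub>L\<^esub> t \<odot>\<^bsub>L\<^esub> \<langle>a, y\<rangle>\<^bsub>L\<^esub>) \<oplus>\<^bsub>L\<^esub> s \<odot>\<^bsub>L\<^esub> \<langle>y, b\<rangle>\<^bsub>L\<^esub>"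
        unfolding u(3) v(3) using u(1,2) v(1,2) y(1) ideal_carrierD[OF A] bracket_closed bracket_self[OF y(1)]
        by (simp add: bracket_add_left bracket_add_right bracket_smult_left bracket_smult_right M.a_ac)
      then show ?thesis
        using AA u v Ay yA by (simp add: subspace_add[OF \<Phi>s] subspace_smult[OF \<Phi>s])
    qed
    then show False using abelianI nab by blast
  qed
  \<comment> \<open>By \<open>ye\<close>, y acts on (phi(L) + F e)/phi(L) by a nonzero scalar, so
    \<open>ad y\<close> is not nilpotent.\<close>
  have yN: "y \<notin> ad_nil"
  proof
    assume "y \<in> ad_nil"
    then obtain n where "ad_pow n y e = \<zero>\<^bsub>L\<^esub>"
      using ec unfolding ad_nil_def by blast
    then show False
      using nilpotent_bracket_adjoin[OF \<Phi> A ec y(1), of n e] subspace_zero[OF \<Phi>s] \<Phi>A(2) ye by simp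
  qed
  \<comment> \<open>\<open>ad_nil\<close> contains phi(L) + F e, which has codimension one, and it
    misses y.\<close>
  have N: "ad_nil = ?A"
    using subspace_between_adjoin[OF As y(1) ad_nil_subspace] top subspace_subset[OF ad_nil_subspace]
      adjoin_minimal[OF ad_nil_subspace \<Phi>N e(1)] yN y(1) by blast
  have "nilpotent_length K L = 2"
    unfolding nilpotent_length_def
  proof (rule Least_equality)
    show "upper_nilpotent K L 2 = carrier L"
      by (rule upper_nilpotent_2)
    fix n assume n: "upper_nilpotent K L n = carrier L"
    have "n \<noteq> 0"
    proof
      assume "n = 0"
      then have "y = \<zero>\<^bsub>L\<^esub>" using n y(1) by auto
      then show False using y(2) subspace_zero[OF As] by simp
    qed
    moreover have "n \<noteq> 1"
      using n upper_nilpotent_1 yN y(1) by auto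
    ultimately show "2 \<le> n" by simp
  qed
  moreover have "chief_factor K L ad_nil ?\<Phi>"
    using chief_factor_adjoin[OF \<Phi> A ec e(2)] N by simp
  moreover have "chief_factor K L (carrier L) ad_nil"
    using chief_factor_adjoin[OF ad_nil_ideal _ y(1) yN] top carrier_ideal N by simp
  moreover have "frattini_series K L 2 = ad_nil"
  proof -
    interpret N: lie_quotient K L ad_nil
      using lie_quotientI[OF ad_nil_ideal] .
    \<comment> \<open>Having codimension one, N is itself among the maximal subalgebras containing
      N, so their intersection is N.\<close>
    have "maximal_subalgebra K ad_nil L"
      using adjoin_carrier_maximal[OF ideal_subalgebra[OF ad_nil_ideal] y(1) yN] top N by simp
    then have "{x \<in> carrier L. \<forall>M. maximal_subalgebra K M L \<and> ad_nil \<subseteq> M \<longrightarrow> x \<in> M} = ad_nil"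
      using ideal_subset[OF ad_nil_ideal] by blast
    then show ?thesis
      using N.quot_preimage_frattini upper_nilpotent_1 by (simp add: frattini_series_def)
  qed
  moreover have "{1..2::nat} = {1, 2}" by auto
  ultimately show ?thesis
    unfolding extreme_def
    using upper_nilpotent_1 upper_nilpotent_2 frattini_series_1 by auto
qed

end

theorem corollary3p7:
  fixes F :: "('a, 'n) ring_scheme" and L :: "('a, 'b, 'm) lie_algebra_scheme"
  assumes "lie_algebra F L"
    and "vectorspace.fin_dim F L"
    and "carrier L \<noteq> {\<zero>\<^bsub>L\<^esub>}"
    and "supersolvable F L"
  shows "extreme F L \<longleftrightarrow>
    vectorspace.dim F L = 1 \<or>
    (vectorspace.dim F (lie_quot L (frattini F L)) = 2 \<and>
     \<not> lie_abelian (lie_quot L (frattini F L)))"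
proof -
  interpret lie_algebra F L by fact
  obtain m I where "flagged_lie_algebra F L m I"
    using assms(2,4) by (rule supersolvable_flag)
  then interpret flagged_lie_algebra F L m I .
  show ?thesis
    using extreme_imp[OF assms(2,3)] extreme_if_dim_1[OF assms(2,3)] extreme_if_quotient[OF assms(2)]
    by blast
qed

end
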